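(* For every family $\{x_q\}_{q\in\mathbb{Q}^\ast}$ in a compact metric space $(X,d)$ and every $\vec q=(q_n)_{n\in\mathbb{N}}\in\mathbb{Q}^\infty(\upsilon)$ there exist an extraction $\vec r=(r_n)_{n\in\mathbb{N}}$ of $\vec q$ and $x_0\in X$ such that $$R_1\text{-}\lim_{q\in FS[(r_n(i_n,j_n))_{n\in\mathbb{N}}]}x_q=x_0\qquad(\text{in particular }x_{r_n(i_n,j_n)}\to x_0),$$ uniformly for every $((i_n,j_n))_{n\in\mathbb{N}}\subseteq\mathbb{N}\times\mathbb{N}$ with $1\le i_n,j_n\le n$.
   Context: Notation: $\mathbb{N}=\{1,2,\ldots\}$, $\mathbb{Z}^\ast=\mathbb{Z}\setminus\{0\}$, $\mathbb{Q}^\ast=\mathbb{Q}\setminus\{0\}$. Words. $\widetilde L$ is the set of functions $w$ from a nonempty finite set $dom(w)\subset\mathbb{Z}^\ast$ to $\mathbb{N}$ with $1\le w(t)\le|t|$ for all $t\in dom(w)$. Let $\upsilon\notin\mathbb{N}$ be a symbol (variable). $dom^-(w)$, $dom^+(w)$ are the sets of negative, respectively positive, elements of $dom(w)$. $\widetilde L_0(\upsilon)$ is the set of functions $w$ from a nonempty finite $dom(w)\subset\mathbb{Z}^\ast$ to $\mathbb{N}\cup\{\upsilon\}$ with each $w(t)$ either $\upsilon$ or in $\{1,\ldots,|t|\}$, taking the value $\upsilon$ at some negative and at some positive position. For words $w,u$ with disjoint domains, $w\star u$ is the word on $dom(w)\cup dom(u)$ extending both. $w<_{R_1}u$ means $dom(u)=A_1\cup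 A_2$ with $A_1,A_2\neq\emptyset$ and $\max A_1<\min dom(w)\le\max dom(w)<\min A_2$. For $w\in\widetilde L_0(\upsilon)$ and $1\le a\le\min dom^+(w)$, $1\le b\le-\max dom^-(w)$, $w(a,b)$ is $w$ with $\upsilon$ replaced by $a$ at positive positions and by $b$ at negative positions; $w(\upsilon,\upsilon)=w$. Rationals as words. The map $g:\widetilde L\to\mathbb{Q}^\ast$, $g(w)=\sum_{t\in dom^-(w)}w(t)\frac{(-1)^{-t}}{(-t+1)!}+\sum_{t\in dom^+(w)}w(t)(-1)^{t+1}t!$, is a bijection (Budak–Işik–Pym). For $w\in\widetilde L_0(\upsilon)$, $g(w)$ denotes the function $q$ with $q(i,j)=g(w(j,i))\in\mathbb{Q}^\ast$ for $1\le i\le-\max dom^-(w)$, $1\le j\le\min dom^+(w)$. Such a $q=g(w)$ is regarded as coming with its word $w$. $\mathbb{Q}^\infty(\upsilon)$ is the set of sequences $\vec q=(q_n)_{n\in\mathbb{N}}$, $q_n=g(w_n)$, with $w_n\in\widetilde L_0(\upsilon)$ and $w_n<_{R_1}w_{n+1}$ for all $n$. An extraction of $\vec q=(g(w_n))_n$ is a sequence $\vec r=(r_n)_n\in\mathbb{Q}^\infty(\upsilon)$, $r_n=g(u_n)$, with $u_n\in\widetilde L_0(\upsilon)$, $u_n<_{R_1}u_{n+1}$, and each $u_n$ of the form $w_{n_1}(a_1,b_1)\star\cdots\star w_{n_\lambda}(a_\lambda,b_\lambda)$ with $\lambda\in\mathbb{N}$, $n_1<\cdots<n_\lambda$, each $(a_l,b_l)\in\{1,\ldots,n_l\}^2\cup\{(\upsilon,\upsilon)\}$,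 at least one being $(\upsilon,\upsilon)$. (For $\vec r\in\mathbb{Q}^\infty(\upsilon)$, $r_n(i,j)$ is defined for $1\le i,j\le n$.) $FS[(x_n)_{n\in\mathbb{N}}]=\{x_{n_1}+\cdots+x_{n_\lambda}:\lambda\in\mathbb{N},n_1<\cdots<n_\lambda\}$. $R_1\text{-}\lim_{q\in D}x_q=x_0$, for $D=FS[(r_n(i_n,j_n))_n]$, means: for every neighborhood $V$ of $x_0$ there is $n_0\in\mathbb{N}$ with $x_q\in V$ for all $q\in D$ with $\min\{-\max dom^-(g^{-1}(q)),\min dom^+(g^{-1}(q))\}\ge n_0$. Uniformly means that, for each $V$, one $n_0$ works for all admissible sequences $((i_n,j_n))_n$. *)

theory Defs
  imports "HOL-Analysis.Analysis"
begin

text \<open>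
  Throughout, the natural numbers of the source are the positive ones. Sequences indexed by them
  are functions on \<^typ>\<open>nat\<close> whose value at index 0 is irrelevant: every index below is
  required to be at least 1.
\<close>

datatype letter = Num nat | Upsilon

text \<open>
  Constant words and variable words share one type, since the concatenations occurring in
  an extraction mix \<open>w(a,b)\<close> with \<open>w(\<upsilon>,\<upsilon>)\<close>.
\<close>

type_synonym word = "int \<rightharpoonup> letter"

definition dom_neg :: "word \<Rightarrow> int set" where
  "dom_neg w = {t \<in> dom w. t < 0}"

definition dom_pos :: "word \<Rightarrow> int set" where
  "dom_pos w = {t \<in> dom w. t > 0}"

definition L_tilde :: "word set" where
  "L_tilde = {w. finite (dom w) \<and> dom w \<noteq> {} \<and> 0 \<notin> dom w \<and>
     (\<forall>t\<in>dom w. \<exists>k. w t = Some (Num k) \<and> 1 \<le> k \<and> int k \<le> \<bar>t\<bar>)}"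

definition L0_var :: "word set" where
  "L0_var = {w. finite (dom w) \<and> dom w \<noteq> {} \<and> 0 \<notin> dom w \<and>
     (\<forall>t\<in>dom w. w t = Some Upsilon \<or> (\<exists>k. w t = Some (Num k) \<and> 1 \<le> k \<and> int k \<le> \<bar>t\<bar>)) \<and>
     (\<exists>t\<in>dom_neg w. w t = Some Upsilon) \<and> (\<exists>t\<in>dom_pos w. w t = Some Upsilon)}"

definition less_R1 :: "word \<Rightarrow> word \<Rightarrow> bool" where
  "less_R1 w u \<longleftrightarrow> (\<exists>A1 A2. A1 \<noteq> {} \<and> A2 \<noteq> {} \<and> dom u = A1 \<union> A2 \<and>
     Max A1 < Min (dom w) \<and> Min (dom w) \<le> Max (dom w) \<and> Max (dom w) < Min A2)"

text \<open>
  \<open>subst_word w (a, b)\<close> is \<open>w(a,b)\<close>: the variable becomes \<open>a\<close> at positive and \<open>b\<close> at negative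
  positions. Letting \<open>a\<close> and \<open>b\<close> be letters covers \<open>w(\<upsilon>,\<upsilon>) = w\<close> as well.
\<close>

definition subst_word :: "word \<Rightarrow> letter \<times> letter \<Rightarrow> word" where
  "subst_word w ab = (\<lambda>t. if w t = Some Upsilon
     then Some (if t > 0 then fst ab else snd ab) else w t)"

text \<open>The value at \<^const>\<open>Upsilon\<close> is a dummy; only constant words are evaluated.\<close>

primrec letter_val :: "letter \<Rightarrow> nat" where
  "letter_val (Num k) = k"
| "letter_val Upsilon = 0"

definition word_val :: "word \<Rightarrow> int \<Rightarrow> rat" where
  "word_val w t = of_nat (letter_val (the (w t)))"

definition g :: "word \<Rightarrow> rat" where
  "g w = (\<Sum>t\<in>dom_neg w. word_val w t * ((-1) ^ nat (- t) / fact (nat (- t + 1))))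
       + (\<Sum>t\<in>dom_pos w. word_val w t * (-1) ^ nat (t + 1) * fact (nat t))"

definition g_inv :: "rat \<Rightarrow> word" where
  "g_inv = inv_into L_tilde g"

text \<open>
  For a variable word \<open>w\<close>, \<open>g_var w\<close> is the function \<open>q(i,j) = g(w(j,i))\<close>: the first argument is
  substituted at the negative positions. It is meaningful for
  \<open>1 \<le> i \<le> - Max (dom_neg w)\<close> and \<open>1 \<le> j \<le> Min (dom_pos w)\<close>.
\<close>

definition g_var :: "word \<Rightarrow> nat \<Rightarrow> nat \<Rightarrow> rat" where
  "g_var w i j = g (subst_word w (Num j, Num i))"

text \<open>
  An element \<open>q\<^sub>n = g(w\<^sub>n)\<close> of a sequence comes with its word, which the function \<open>g_var (w n)\<close>
  alone need not determine. A sequence is therefore given by its words, and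
  \<open>q\<^sub>n(i,j)\<close> is \<open>g_var (w n) i j\<close>.
\<close>

definition Q_inf :: "(nat \<Rightarrow> word) set" where
  "Q_inf = {w. \<forall>n\<ge>1. w n \<in> L0_var \<and> less_R1 (w n) (w (Suc n))}"

text \<open>The words in the concatenation below have disjoint domains, so \<open>\<star>\<close> is map addition.\<close>

definition is_extraction :: "(nat \<Rightarrow> word) \<Rightarrow> (nat \<Rightarrow> word) \<Rightarrow> bool" where
  "is_extraction u w \<longleftrightarrow> u \<in> Q_inf \<and>
     (\<forall>n\<ge>1. \<exists>ns ab. ns \<noteq> [] \<and> sorted_wrt (<) ns \<and> (\<forall>m\<in>set ns. 1 \<le> m) \<and>
        (\<forall>m\<in>set ns. ab m \<in> {(Num a, Num b) | a b. a \<in> {1..m} \<and> b \<in> {1..m}} \<union> {(Upsilon, Upsilon)}) \<and>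
        (\<exists>m\<in>set ns. ab m = (Upsilon, Upsilon)) \<and>
        u n = foldr (++) (map (\<lambda>m. subst_word (w m) (ab m)) ns) Map.empty)"

definition FS :: "(nat \<Rightarrow> rat) \<Rightarrow> rat set" where
  "FS y = {sum y F | F. finite F \<and> F \<noteq> {} \<and> F \<subseteq> {1..}}"

definition R1_depth :: "rat \<Rightarrow> int" where
  "R1_depth q = min (- Max (dom_neg (g_inv q))) (Min (dom_pos (g_inv q)))"

definition admissible :: "(nat \<Rightarrow> nat) \<Rightarrow> (nat \<Rightarrow> nat) \<Rightarrow> bool" where
  "admissible i j \<longleftrightarrow> (\<forall>n\<ge>1. 1 \<le> i n \<and> i n \<le> n \<and> 1 \<le> j n \<and> j n \<le> n)"

text \<open>
  Convergence along every \<open>D \<in> \<D>\<close>, uniformly in \<open>D\<close>; the plain limit along a single \<open>D\<close> is the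
  case \<open>\<D> = {D}\<close>.
\<close>

definition R1_lim_uniformly :: "'a topology \<Rightarrow> (rat \<Rightarrow> 'a) \<Rightarrow> rat set set \<Rightarrow> 'a \<Rightarrow> bool" where
  "R1_lim_uniformly T x \<D> x0 \<longleftrightarrow> x0 \<in> topspace T \<and>
     (\<forall>V. openin T V \<and> x0 \<in> V \<longrightarrow>
        (\<exists>n0::nat. n0 \<ge> 1 \<and> (\<forall>D\<in>\<D>. \<forall>q\<in>D. int n0 \<le> R1_depth q \<longrightarrow> x q \<in> V)))"

end

theory Submission
  imports Defs
begin

text \<open>
  Concatenation makes the words a semigroup, so ultrafilters on words can be multiplied. Take an
  idempotent ultrafilter \<open>p\<close> of constant words over \<open>w\<close> lying in a minimal left ideal, and an
  ultrafilter \<open>q\<close> of variable words over \<open>w\<close> that every substitution maps to \<open>p\<close>. Let \<open>x\<^sub>0\<close> be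
  the limit of \<open>x (g s)\<close> along \<open>p\<close>. A Galvin-Glazer construction then chooses words \<open>u n\<close>, generic
  for \<open>q\<close>, such that each concatenation of instances of the \<open>u n\<close> with least index \<open>m\<close> has its
  value within \<open>1/(m+1)\<close> of \<open>x\<^sub>0\<close>. Since \<open>g\<close> is injective, the depth of a finite sum determines how
  large its least index is, which turns this into the uniform limit.
\<close>

subsection \<open>Ultrafilters\<close>

definition ultra :: "'a filter \<Rightarrow> bool" where
  "ultra F \<longleftrightarrow> F \<noteq> bot \<and> (\<forall>P. eventually P F \<or> eventually (\<lambda>x. \<not> P x) F)"

lemma ultra_not_bot: "ultra F \<Longrightarrow> F \<noteq> bot"
  by (simp add: ultra_def)

lemma not_eventually_and_not:
  "F \<noteq> bot \<Longrightarrow> eventually P F \<Longrightarrow> eventually (\<lambda>x. \<not> P x) F \<Longrightarrow> False"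
  by (drule (1) eventually_conj) (simp add: eventually_False)

lemma ultra_not_eventually_iff:
  "ultra F \<Longrightarrow> \<not> eventually P F \<longleftrightarrow> eventually (\<lambda>x. \<not> P x) F"
  unfolding ultra_def
  by (metis not_eventually_and_not)

text \<open>If \<open>P\<close> holds eventually in the proper filter \<open>G\<close>, its negation
  cannot, so \<open>F\<close>, which decides \<open>P\<close>, must accept \<open>P\<close>. Smaller
  filters are the finer ones here.\<close>

lemma ultra_eqI:
  assumes "ultra F" "G \<le> F" "G \<noteq> bot"
  shows "G = F"
proof (rule order.antisym[OF assms(2)])
  show "F \<le> G"
    unfolding le_filter_def
  proof (intro allI impI)
    fix P assume "eventually P G"
    then have "\<not> eventually (\<lambda>x. \<not> P x) G"
      using assms(3) not_eventually_and_not by blast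
    then show "eventually P F"
      using assms(1,2) unfolding ultra_def le_filter_def by blast
  qed
qed

lemma ultra_filtermap: "ultra F \<Longrightarrow> ultra (filtermap f F)"
  by (auto simp: ultra_def eventually_filtermap filtermap_bot_iff)

text \<open>Zorn's lemma for the reversed order. It takes the place of compactness of the space of
  ultrafilters, with filters for closed sets, and yields ultrafilters, minimal subsemigroups and
  minimal left ideals.\<close>

lemma minimal_filter_exists:
  fixes F :: "'a filter"
  assumes "Q F" "F \<noteq> bot"
    and Inf: "\<And>C. C \<noteq> {} \<Longrightarrow> (\<And>G. G \<in> C \<Longrightarrow> Q G) \<Longrightarrow> Q (Inf C)"
  obtains M where "M \<le> F" "M \<noteq> bot" "Q M"
    "\<And>G. G \<le> M \<Longrightarrow> G \<noteq> bot \<Longrightarrow> Q G \<Longrightarrow> G = M"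
proof -
  let ?A = "{G. G \<le> F \<and> G \<noteq> bot \<and> Q G}"
  have "\<exists>m\<in>?A. \<forall>a\<in>?A. m \<ge> a \<longrightarrow> a = m"
  proof (rule predicate_Zorn)
    show "partial_order_on ?A (relation_of (\<ge>) ?A)"
      by (rule partial_order_on_relation_ofI) auto
    fix C assume "C \<in> Chains (relation_of (\<ge>) ?A)"
    then have sub: "C \<subseteq> ?A" and lin: "\<And>G H. G \<in> C \<Longrightarrow> H \<in> C \<Longrightarrow> G \<le> H \<or> H \<le> G"
      by (auto simp: Chains_def relation_of_def)
    show "\<exists>u\<in>?A. \<forall>a\<in>C. u \<le> a"
    proof (cases "C = {}")
      case True
      with assms show ?thesis by auto
    next
      case False
      \<comment> \<open>In a chain a single member already witnesses what is eventually true in the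
        infimum, so the infimum stays proper.\<close>
      have "eventually P (Inf C) \<longleftrightarrow> (\<exists>G\<in>C. eventually P G)" for P
        by (rule eventually_Inf_base[OF False]) (metis lin inf.absorb1 inf.absorb2 order.refl)
      then have "Inf C \<noteq> bot"
        using sub by (auto simp: trivial_limit_def)
      moreover have "Inf C \<le> F"
        using False sub by (metis (lifting) Inf_lower2 all_not_in_conv mem_Collect_eq subsetD)
      moreover have "Q (Inf C)"
        using sub by (intro Inf[OF False]) auto
      ultimately show ?thesis
        by (intro bexI[of _ "Inf C"]) (auto intro: Inf_lower)
    qed
  qed
  then show thesis
    using that by (metis (mono_tags, lifting) mem_Collect_eq order_trans)
qed

text \<open>A minimal proper filter decides every \<open>P\<close>: restricting it to
  \<open>P\<close> gives either \<open>bot\<close> or the same filter.\<close>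

lemma ultra_exists:
  assumes "F \<noteq> bot"
  obtains U where "U \<le> F" "ultra U"
proof -
  obtain U where U: "U \<le> F" "U \<noteq> bot"
    and min: "\<And>G. G \<le> U \<Longrightarrow> G \<noteq> bot \<Longrightarrow> G = U"
    using minimal_filter_exists[of "\<lambda>_. True" F] assms by auto
  have "eventually P U \<or> eventually (\<lambda>x. \<not> P x) U" for P
  proof (cases "inf U (principal {x. P x}) = bot")
    case True
    then have "eventually (\<lambda>x. False) (inf U (principal {x. P x}))" by simp
    then show ?thesis by (simp add: eventually_inf_principal)
  next
    case False
    then have "inf U (principal {x. P x}) = U" by (intro min) auto
    then have "U \<le> principal {x. P x}" by (metis inf.cobounded2)
    then show ?thesis by (simp add: le_principal)
  qed
  with U that show thesis by (auto simp: ultra_def)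
qed

text \<open>Otherwise each point has a neighbourhood that \<open>f\<close> eventually avoids along
  \<open>p\<close>. Finitely many of these cover the space, and \<open>f\<close> would avoid all of
  them at once.\<close>

lemma compact_space_ultra_limit:
  assumes "compact_space T" "ultra p" "eventually (\<lambda>s. f s \<in> topspace T) p"
  obtains l where "l \<in> topspace T"
    "\<And>V. openin T V \<Longrightarrow> l \<in> V \<Longrightarrow> eventually (\<lambda>s. f s \<in> V) p"
proof -
  have "\<exists>l\<in>topspace T. \<forall>V. openin T V \<longrightarrow> l \<in> V \<longrightarrow> eventually (\<lambda>s. f s \<in> V) p"
  proof (rule ccontr)
    assume "\<not> ?thesis"
    then obtain V where V: "\<And>l. l \<in> topspace T \<Longrightarrow>
        openin T (V l) \<and> l \<in> V l \<and> \<not> eventually (\<lambda>s. f s \<in> V l) p"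
      by metis
    then have "\<forall>U \<in> V ` topspace T. openin T U" "topspace T \<subseteq> \<Union>(V ` topspace T)"
      by auto
    then obtain \<F> where \<F>: "finite \<F>" "\<F> \<subseteq> V ` topspace T" "topspace T \<subseteq> \<Union>\<F>"
      using assms(1) unfolding compact_space_def compactin_def by meson
    have "eventually (\<lambda>s. \<forall>U\<in>\<F>. f s \<notin> U) p"
      using \<F>(1,2) V ultra_not_eventually_iff[OF assms(2)]
      by (intro eventually_ball_finite) auto
    with assms(3) have "eventually (\<lambda>s. False) p"
      by eventually_elim (use \<F>(3) in auto)
    then show False
      using ultra_not_bot[OF assms(2)] by (simp add: eventually_False)
  qed
  with that show thesis by blast
qed

subsection \<open>Products of filters on a semigroup\<close>

context semigroup
begin

text \<open>The product of ultrafilters on the Stone-Cech compactification, extended to filters. How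
  far out the right factor must lie may depend on the left one.\<close>

definition filter_mult :: "'a filter \<Rightarrow> 'a filter \<Rightarrow> 'a filter" (infixl \<open>\<star>\<close> 70) where
  "F \<star> G = Abs_filter (\<lambda>P. eventually (\<lambda>s. eventually (\<lambda>t. P (s \<^bold>* t)) G) F)"

lemma eventually_filter_mult:
  "eventually P (F \<star> G) \<longleftrightarrow> eventually (\<lambda>s. eventually (\<lambda>t. P (s \<^bold>* t)) G) F"
  unfolding filter_mult_def
proof (rule eventually_Abs_filter, rule is_filter.intro)
  fix P Q assume "eventually (\<lambda>s. eventually (\<lambda>t. P (s \<^bold>* t)) G) F"
    "eventually (\<lambda>s. eventually (\<lambda>t. Q (s \<^bold>* t)) G) F"
  then show "eventually (\<lambda>s. eventually (\<lambda>t. P (s \<^bold>* t) \<and> Q (s \<^bold>* t)) G) F"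
    by (simp add: eventually_conj_iff)
next
  fix P Q assume "\<forall>x. P x \<longrightarrow> Q x" "eventually (\<lambda>s. eventually (\<lambda>t. P (s \<^bold>* t)) G) F"
  then show "eventually (\<lambda>s. eventually (\<lambda>t. Q (s \<^bold>* t)) G) F"
    by (elim eventually_mono) auto
qed simp

lemma filter_mult_assoc: "F \<star> G \<star> H = F \<star> (G \<star> H)"
  by (simp add: filter_eq_iff eventually_filter_mult assoc)

lemma filter_mult_mono: "F \<le> F' \<Longrightarrow> G \<le> G' \<Longrightarrow> F \<star> G \<le> F' \<star> G'"
  unfolding le_filter_def eventually_filter_mult
  by (blast intro: eventually_mono)

lemma filter_mult_not_bot: "F \<noteq> bot \<Longrightarrow> G \<noteq> bot \<Longrightarrow> F \<star> G \<noteq> bot"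
  by (simp add: trivial_limit_def eventually_filter_mult)

lemma ultra_filter_mult:
  assumes "ultra F" "ultra G"
  shows "ultra (F \<star> G)"
proof -
  have "eventually P (F \<star> G) \<or> eventually (\<lambda>x. \<not> P x) (F \<star> G)" for P
    using assms by (simp add: eventually_filter_mult flip: ultra_not_eventually_iff)
  with assms filter_mult_not_bot show ?thesis by (simp add: ultra_def)
qed

lemma filtermap_filter_mult:
  assumes "\<And>s t. h (s \<^bold>* t) = h s \<^bold>* h t"
  shows "filtermap h (F \<star> G) = filtermap h F \<star> filtermap h G"
  by (simp add: filter_eq_iff eventually_filtermap eventually_filter_mult assms)

text \<open>The coarsest filter \<open>F\<close> with \<open>F \<star> r \<le> p\<close>. For
  ultrafilters it describes the preimage of \<open>p\<close> under right multiplication by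
  \<open>r\<close>.\<close>

definition left_quotient :: "'a filter \<Rightarrow> 'a filter \<Rightarrow> 'a filter" where
  "left_quotient p r = (INF A\<in>{A. eventually A p}. principal {s. eventually (\<lambda>t. A (s \<^bold>* t)) r})"

lemma eventually_left_quotient:
  "eventually P (left_quotient p r) \<longleftrightarrow>
    (\<exists>A. eventually A p \<and> (\<forall>s. eventually (\<lambda>t. A (s \<^bold>* t)) r \<longrightarrow> P s))"
  unfolding left_quotient_def
proof (subst eventually_INF_base)
  fix A B assume "A \<in> {A. eventually A p}" "B \<in> {A. eventually A p}"
  then show "\<exists>D\<in>{A. eventually A p}. principal {s. eventually (\<lambda>t. D (s \<^bold>* t)) r}
      \<le> inf (principal {s. eventually (\<lambda>t. A (s \<^bold>* t)) r})
            (principal {s. eventually (\<lambda>t. B (s \<^bold>* t)) r})"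
    by (intro bexI[of _ "\<lambda>x. A x \<and> B x"]) (auto simp: eventually_conj_iff)
qed (auto simp: eventually_principal intro: exI[of _ "\<lambda>_. True"])

lemma le_left_quotient_iff: "F \<le> left_quotient p r \<longleftrightarrow> F \<star> r \<le> p"
proof
  assume le: "F \<le> left_quotient p r"
  show "F \<star> r \<le> p"
    unfolding le_filter_def eventually_filter_mult
  proof (intro allI impI)
    fix A assume "eventually A p"
    then have "eventually (\<lambda>s. eventually (\<lambda>t. A (s \<^bold>* t)) r) (left_quotient p r)"
      by (auto simp: eventually_left_quotient)
    with le show "eventually (\<lambda>s. eventually (\<lambda>t. A (s \<^bold>* t)) r) F"
      by (simp add: le_filter_def)
  qed
next
  assume "F \<star> r \<le> p"
  then show "F \<le> left_quotient p r"
    unfolding le_filter_def eventually_left_quotient eventually_filter_mult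
    by (metis (no_types, lifting) eventually_mono)
qed

text \<open>If the meet were trivial, some \<open>A\<close> in \<open>p\<close> would be rejected by
  \<open>r\<close> after translation by each \<open>s\<close> of a set in \<open>F\<close>. Since
  \<open>r\<close> decides, the complement of \<open>A\<close> would then belong to
  \<open>F \<star> r\<close>, hence to \<open>p\<close>.\<close>

lemma inf_left_quotient_not_bot:
  assumes "ultra r" "p \<noteq> bot" "p \<le> F \<star> r"
  shows "inf F (left_quotient p r) \<noteq> bot"
proof
  assume "inf F (left_quotient p r) = bot"
  then have "eventually (\<lambda>_. False) (inf F (left_quotient p r))" by simp
  then obtain B A where B: "eventually B F" and A: "eventually A p"
    and AB: "\<And>s. B s \<Longrightarrow> \<not> eventually (\<lambda>t. A (s \<^bold>* t)) r"
    unfolding eventually_inf eventually_left_quotient by meson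
  have "eventually (\<lambda>s. eventually (\<lambda>t. \<not> A (s \<^bold>* t)) r) F"
    using B by (rule eventually_mono) (use AB ultra_not_eventually_iff[OF assms(1)] in auto)
  then have "eventually (\<lambda>x. \<not> A x) p"
    using assms(3) by (simp add: le_filter_def eventually_filter_mult)
  with A have "eventually (\<lambda>x. False) p"
    by eventually_elim auto
  with assms(2) show False by (simp add: eventually_False)
qed

text \<open>Every ultrafilter in the closed set \<open>F \<star> r\<close> is a multiple of
  \<open>r\<close>. The factor \<open>s\<close> need not be an ultrafilter, as only the equation is
  used.\<close>

lemma left_factor_exists:
  assumes "ultra r" "ultra p" "p \<le> F \<star> r"
  obtains s where "s \<le> F" "s \<noteq> bot" "s \<star> r = p"
proof
  let ?s = "inf F (left_quotient p r)"
  show "?s \<noteq> bot"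
    using assms by (intro inf_left_quotient_not_bot) (auto simp: ultra_not_bot)
  then show "?s \<star> r = p"
    using assms
    by (intro ultra_eqI) (simp_all add: filter_mult_not_bot ultra_not_bot flip: le_left_quotient_iff)
qed simp

text \<open>
  Ellis' theorem; a filter stands for the closed set of the ultrafilters refining it.
\<close>

lemma idempotent_ultra_exists:
  assumes "F \<star> F \<le> F" "F \<noteq> bot"
  obtains p where "p \<le> F" "ultra p" "p \<star> p = p"
proof -
  obtain M where M: "M \<le> F" "M \<noteq> bot" "M \<star> M \<le> M"
    and min: "\<And>G. G \<le> M \<Longrightarrow> G \<noteq> bot \<Longrightarrow> G \<star> G \<le> G \<Longrightarrow> G = M"
  proof (rule minimal_filter_exists[of "\<lambda>F. F \<star> F \<le> F" F])
    fix C :: "'a filter set" assume "\<And>G. G \<in> C \<Longrightarrow> G \<star> G \<le> G"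
    then show "Inf C \<star> Inf C \<le> Inf C"
      by (intro Inf_greatest) (meson Inf_lower filter_mult_mono order_trans)
  qed (use assms in auto)
  obtain p where p: "p \<le> M" "ultra p"
    using ultra_exists[OF M(2)] .
  \<comment> \<open>\<open>M \<star> p\<close> is again a closed subsemigroup inside the minimal
    \<open>M\<close>.\<close>
  have Mp: "M \<star> p = M"
  proof (rule min)
    show "M \<star> p \<le> M" using M(3) filter_mult_mono[OF order.refl p(1)] by (rule order_trans[rotated])
    show "M \<star> p \<noteq> bot" using M p by (simp add: filter_mult_not_bot ultra_not_bot)
    have "M \<star> p \<star> (M \<star> p) = M \<star> (p \<star> M) \<star> p" by (simp add: filter_mult_assoc)
    also have "\<dots> \<le> M \<star> p"
      by (meson M(3) p(1) filter_mult_mono order.refl order_trans)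
    finally show "M \<star> p \<star> (M \<star> p) \<le> M \<star> p" .
  qed
  \<comment> \<open>This stands for the elements of \<open>M\<close> that fix \<open>p\<close> from
    the left. They form a closed subsemigroup, nonempty because \<open>p\<close> refines
    \<open>M = M \<star> p\<close>.\<close>
  let ?H = "inf M (left_quotient p p)"
  have Hp: "?H \<star> p \<le> p" by (simp flip: le_left_quotient_iff)
  have "?H = M"
  proof (rule min)
    show "?H \<noteq> bot"
      using p Mp by (intro inf_left_quotient_not_bot) (auto simp: ultra_not_bot)
    have "?H \<star> ?H \<le> M"
      by (meson M(3) filter_mult_mono inf.cobounded1 order_trans)
    moreover have "?H \<star> ?H \<star> p \<le> p"
      using Hp filter_mult_mono[OF order.refl Hp] by (metis filter_mult_assoc order_trans)
    ultimately show "?H \<star> ?H \<le> ?H" by (simp add: le_left_quotient_iff)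
  qed simp
  \<comment> \<open>All of \<open>M\<close> fixes \<open>p\<close>, so
    \<open>M = M \<star> p \<le> p\<close>, and \<open>M\<close> shrinks to the single point
    \<open>p\<close>.\<close>
  with Hp Mp have "M \<le> p" by simp
  with p have "M = p" by simp
  with Mp that M(1) p(2) show thesis by blast
qed

text \<open>
  Here \<open>C\<close> plays the constant words, \<open>V\<close> the variable words and \<open>T i\<close> the substitutions. Since
  \<open>p\<close> is idempotent in a minimal left ideal \<open>L\<close>, it is minimal among the idempotents of \<open>C\<close>,
  whereas \<open>q = p \<star> e\<close> is an idempotent below \<open>p\<close>, so that each of its images \<open>T i q\<close> equals \<open>p\<close>.
\<close>

theorem variable_ultrafilter_exists:
  fixes C V :: "'a filter" and T :: "'i \<Rightarrow> 'a \<Rightarrow> 'a"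
  assumes "C \<noteq> bot" "V \<noteq> bot"
    and CC: "C \<star> C \<le> C" and CV: "C \<star> V \<le> V" and VC: "V \<star> C \<le> V" and VV: "V \<star> V \<le> V"
    and hom: "\<And>i s t. T i (s \<^bold>* t) = T i s \<^bold>* T i t"
    and TC: "\<And>i. i \<in> I \<Longrightarrow> eventually (\<lambda>s. T i s = s) C"
    and TV: "\<And>i. i \<in> I \<Longrightarrow> filtermap (T i) V \<le> C"
  obtains p q where "ultra p" "p \<le> C" "p \<star> p = p" "q \<noteq> bot" "q \<le> V"
    "\<And>i. i \<in> I \<Longrightarrow> filtermap (T i) q = p"
proof -
  \<comment> \<open>\<open>L\<close> is a minimal closed left ideal of \<open>C\<close>.\<close>
  obtain L where L: "L \<le> C" "L \<noteq> bot" "C \<star> L \<le> L"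
    and min: "\<And>G. G \<le> L \<Longrightarrow> G \<noteq> bot \<Longrightarrow> C \<star> G \<le> G \<Longrightarrow> G = L"
  proof (rule minimal_filter_exists[of "\<lambda>F. C \<star> F \<le> F" C])
    fix D :: "'a filter set" assume "\<And>G. G \<in> D \<Longrightarrow> C \<star> G \<le> G"
    then show "C \<star> Inf D \<le> Inf D"
      by (intro Inf_greatest) (meson Inf_lower filter_mult_mono order.refl order_trans)
  qed (use assms in auto)
  have "L \<star> L \<le> L"
    using L by (meson filter_mult_mono order.refl order_trans)
  then obtain p where p: "p \<le> L" "ultra p" "p \<star> p = p"
    using idempotent_ultra_exists L(2) by metis
  have pC: "p \<le> C" using p(1) L(1) by (rule order_trans)
  have pV: "p \<star> V \<le> V"
    using CV pC by (meson filter_mult_mono order.refl order_trans)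
  have "V \<star> p \<star> (V \<star> p) = V \<star> (p \<star> V) \<star> p" by (simp add: filter_mult_assoc)
  also have "\<dots> \<le> V \<star> p"
    by (meson VV pV filter_mult_mono order.refl order_trans)
  finally have "V \<star> p \<star> (V \<star> p) \<le> V \<star> p" .
  moreover have "V \<star> p \<noteq> bot"
    using assms p by (simp add: filter_mult_not_bot ultra_not_bot)
  ultimately obtain e where e: "e \<le> V \<star> p" "ultra e" "e \<star> e = e"
    using idempotent_ultra_exists by metis
  \<comment> \<open>\<open>e\<close> has the form \<open>s \<star> p\<close>, and \<open>p\<close>
    is idempotent. The factor \<open>p\<close> still missing on the left is supplied by passing to
    \<open>p \<star> e\<close>.\<close>
  have ep: "e \<star> p = e"
    using left_factor_exists[OF p(2) e(2,1)] by (metis filter_mult_assoc p(3))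
  have eV: "e \<le> V"
    using e(1) VC pC by (meson filter_mult_mono order.refl order_trans)
  have "p \<star> e \<le> V"
    using pV eV by (meson filter_mult_mono order.refl order_trans)
  moreover have "filtermap (T i) (p \<star> e) = p" if "i \<in> I" for i
  proof -
    let ?r = "filtermap (T i) (p \<star> e)"
    have "eventually (\<lambda>s. T i s = s) p"
      using TC[OF that] pC by (auto simp: le_filter_def)
    then have "eventually (\<lambda>s. P (T i s) \<longleftrightarrow> P s) p" for P
      by (rule eventually_mono) simp
    \<comment> \<open>Substitution fixes constant words, hence also \<open>p\<close>.\<close>
    then have Tp: "filtermap (T i) p = p"
      by (simp add: filter_eq_iff eventually_filtermap eventually_subst)
    have ru: "ultra ?r" using p e by (simp add: ultra_filtermap ultra_filter_mult)
    have rp: "?r \<star> p = ?r"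
      using filtermap_filter_mult[of "T i" "p \<star> e" p] hom Tp ep by (simp add: filter_mult_assoc)
    have pr: "p \<star> ?r = ?r"
      using filtermap_filter_mult[of "T i" p "p \<star> e"] hom Tp p(3) by (simp flip: filter_mult_assoc)
    have rr: "?r \<star> ?r = ?r"
    proof -
      have "p \<star> e \<star> (p \<star> e) = p \<star> e"
        by (metis filter_mult_assoc ep e(3))
      then show ?thesis
        using filtermap_filter_mult[of "T i" "p \<star> e" "p \<star> e"] hom by simp
    qed
    have "?r \<le> C"
      using filtermap_mono[OF \<open>p \<star> e \<le> V\<close>] TV[OF that] by (rule order_trans)
    \<comment> \<open>\<open>?r = ?r \<star> p\<close> with \<open>?r\<close> in \<open>C\<close>
      and \<open>p\<close> in the left ideal \<open>L\<close>.\<close>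
    then have "?r \<le> L"
      using L(3) p(1) rp by (metis filter_mult_mono order_trans)
    \<comment> \<open>By minimality the left ideal generated by \<open>?r\<close> is all of
      \<open>L\<close>. So \<open>p = s \<star> ?r\<close> for some \<open>s\<close>, and
      idempotence of \<open>?r\<close> gives \<open>p \<star> ?r = p\<close>; but
      \<open>p \<star> ?r\<close> is also \<open>?r\<close>.\<close>
    have "C \<star> ?r = L"
    proof (rule min)
      show "C \<star> ?r \<le> L" using L(3) \<open>?r \<le> L\<close> by (meson filter_mult_mono order.refl order_trans)
      show "C \<star> ?r \<noteq> bot" using assms(1) ru by (simp add: filter_mult_not_bot ultra_not_bot)
      show "C \<star> (C \<star> ?r) \<le> C \<star> ?r"
        using CC by (metis filter_mult_assoc filter_mult_mono order.refl)
    qed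
    then obtain s where "s \<star> ?r = p"
      using left_factor_exists[OF ru p(2)] p(1) by metis
    then have "p \<star> ?r = p"
      using rr by (metis filter_mult_assoc)
    with pr show "?r = p" by simp
  qed
  moreover have "p \<star> e \<noteq> bot" using p e by (simp add: filter_mult_not_bot ultra_not_bot)
  ultimately show thesis using that p pC by blast
qed

text \<open>Galvin-Glazer: since \<open>p\<close> is idempotent, each \<open>A\<close> in
  \<open>p\<close> contains \<open>p\<close>-many \<open>s\<close> whose translate of
  \<open>A\<close> is again in \<open>p\<close>. The maps \<open>T i\<close> carry \<open>q\<close>
  into \<open>p\<close>, so \<open>q\<close>-many \<open>u\<close> have all of their finitely many
  images among these \<open>s\<close>.\<close>

lemma homogeneous_sequence_exists:
  fixes T :: "'i \<Rightarrow> 'a \<Rightarrow> 'a"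
  assumes idem: "p \<star> p = p" and q: "q \<noteq> bot"
    and T: "\<And>n i. i \<in> I n \<Longrightarrow> filtermap (T i) q \<le> p" and fin: "\<And>n. finite (I n)"
    and B: "\<And>n. eventually (B n) p"
    and D: "eventually D q" and R: "\<And>u. D u \<Longrightarrow> eventually (R u) q"
  obtains u A where "\<And>n. D (u n)" "\<And>n. R (u n) (u (Suc n))"
    "\<And>n s. A n s \<Longrightarrow> B n s" "\<And>n s. A (Suc n) s \<Longrightarrow> A n s"
    "\<And>n i. i \<in> I n \<Longrightarrow> A n (T i (u n))"
    "\<And>n i s. i \<in> I n \<Longrightarrow> A (Suc n) s \<Longrightarrow> A n (T i (u n) \<^bold>* s)"
proof -
  define good where "good n A u \<longleftrightarrow> eventually A p \<and> (\<forall>s. A s \<longrightarrow> B n s) \<and> D u \<and>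
    (\<forall>i\<in>I n. A (T i u) \<and> eventually (\<lambda>s. A (T i u \<^bold>* s)) p)" for n A u
  have step: "\<exists>u. good n A u \<and> E u"
    if A: "eventually A p" "\<And>s. A s \<Longrightarrow> B n s" and E: "eventually E q" for n A E
  proof -
    have "eventually (\<lambda>s. A s \<and> eventually (\<lambda>t. A (s \<^bold>* t)) p) p"
      using A(1) eventually_filter_mult[of A p p] unfolding idem by (simp add: eventually_conj_iff)
    then have "eventually (\<lambda>u. A (T i u) \<and> eventually (\<lambda>t. A (T i u \<^bold>* t)) p) q" if "i \<in> I n" for i
      using T[OF that] by (auto simp: le_filter_def eventually_filtermap)
    then have "eventually (\<lambda>u. \<forall>i\<in>I n. A (T i u) \<and> eventually (\<lambda>t. A (T i u \<^bold>* t)) p) q"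
      using fin by (simp add: eventually_ball_finite)
    with D E have "eventually (\<lambda>u. good n A u \<and> E u) q"
    proof eventually_elim
      case (elim u)
      show ?case unfolding good_def by (intro conjI allI impI A elim)
    qed
    with q show ?thesis using eventually_happens by blast
  qed
  \<comment> \<open>The recursion carries pairs: the current set \<open>A\<close> and the element
    \<open>u\<close> chosen in it at stage \<open>n\<close>.\<close>
  have "\<exists>z. \<forall>n. (case z n of (A, u) \<Rightarrow> good n A u) \<and>
    (case z n of (A, u) \<Rightarrow> case z (Suc n) of (A', u') \<Rightarrow> R u u' \<and>
      (\<forall>s. A' s \<longrightarrow> A s \<and> (\<forall>i\<in>I n. A (T i u \<^bold>* s))))"
  proof (rule dependent_nat_choice)
    show "\<exists>z. case z of (A, u) \<Rightarrow> good 0 A u"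
      using step[of "B 0" 0 "\<lambda>_. True"] B by auto
  next
    fix z n assume "case z of (A, u) \<Rightarrow> good n A u"
    then obtain A u where z: "z = (A, u)" and g: "good n A u" by (cases z) auto
    \<comment> \<open>The next set keeps only those \<open>s\<close> that may follow every image of
      \<open>u\<close> without leaving \<open>A\<close>; it lies in \<open>p\<close> because
      \<open>u\<close> is good.\<close>
    let ?A = "\<lambda>s. A s \<and> B (Suc n) s \<and> (\<forall>i\<in>I n. A (T i u \<^bold>* s))"
    have "eventually ?A p"
      using g B fin by (auto simp: good_def eventually_conj_iff eventually_ball_finite)
    moreover have "eventually (R u) q" using g R by (auto simp: good_def)
    ultimately obtain u' where "good (Suc n) ?A u'" "R u u'"
      using step[of ?A "Suc n" "R u"] by blast
    then show "\<exists>z'. (case z' of (A, u) \<Rightarrow> good (Suc n) A u) \<and>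
      (case z of (A, u) \<Rightarrow> case z' of (A', u') \<Rightarrow> R u u' \<and>
        (\<forall>s. A' s \<longrightarrow> A s \<and> (\<forall>i\<in>I n. A (T i u \<^bold>* s))))"
      by (intro exI[of _ "(?A, u')"]) (simp add: z)
  qed
  then obtain z where z: "\<And>n. good n (fst (z n)) (snd (z n))"
    "\<And>n. R (snd (z n)) (snd (z (Suc n)))"
    "\<And>n s. fst (z (Suc n)) s \<Longrightarrow> fst (z n) s \<and> (\<forall>i\<in>I n. fst (z n) (T i (snd (z n)) \<^bold>* s))"
    by (auto simp: case_prod_beta)
  show thesis
    by (rule that[of "\<lambda>n. snd (z n)" "\<lambda>n. fst (z n)"]) (use z in \<open>auto simp: good_def\<close>)
qed

end

subsection \<open>Injectivity of the coding of rationals\<close>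

text \<open>The default 0 outside the domain is a value that no letter of a constant word takes, so
  such a word can be recovered from its digits.\<close>

definition digit :: "word \<Rightarrow> int \<Rightarrow> int" where
  "digit w t = (case w t of None \<Rightarrow> 0 | Some l \<Rightarrow> int (letter_val l))"

definition weight :: "int \<Rightarrow> rat" where
  "weight t = (if t < 0 then (-1) ^ nat (- t) / fact (nat (- t + 1))
    else (-1) ^ nat (t + 1) * fact (nat t))"

text \<open>Padding with zero digits lets the values of different words be compared over one common
  index set.\<close>

lemma g_eq_sum_digit:
  assumes "finite S" "dom w \<subseteq> S" "0 \<notin> dom w"
  shows "g w = (\<Sum>t\<in>S. of_int (digit w t) * weight t)"
proof -
  have "finite (dom w)" using assms finite_subset by blast
  then have fin: "finite (dom_neg w)" "finite (dom_pos w)"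
    by (auto simp: dom_neg_def dom_pos_def)
  have eq: "dom w = dom_neg w \<union> dom_pos w" "dom_neg w \<inter> dom_pos w = {}"
    using assms(3) by (auto simp: dom_neg_def dom_pos_def not_less intro: order.antisym)
  have "g w = (\<Sum>t\<in>dom_neg w. of_int (digit w t) * weight t)
      + (\<Sum>t\<in>dom_pos w. of_int (digit w t) * weight t)"
    unfolding g_def
    by (intro arg_cong2[of _ _ _ _ "(+)"] sum.cong)
      (auto simp: dom_neg_def dom_pos_def word_val_def digit_def weight_def)
  also have "\<dots> = (\<Sum>t\<in>dom w. of_int (digit w t) * weight t)"
    using fin eq by (simp add: sum.union_disjoint)
  also have "\<dots> = (\<Sum>t\<in>S. of_int (digit w t) * weight t)"
    using assms by (intro sum.mono_neutral_left) (auto simp: digit_def domIff)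
  finally show ?thesis .
qed

lemma fact_div_fact_Ints: "m \<le> n \<Longrightarrow> fact n / fact m \<in> (\<int> :: rat set)"
proof -
  assume "m \<le> n"
  then obtain k :: nat where "fact n = fact m * k" using fact_dvd by blast
  then have "(fact n :: rat) = fact m * of_nat k" by (metis of_nat_fact of_nat_mult)
  then show ?thesis by simp
qed

lemma fact_div_fact_Suc: "fact n / fact (Suc n) = (1 / of_nat (Suc n) :: rat)"
  by simp

lemma weight_scale:
  fixes m :: int
  assumes "m \<noteq> 0"
  obtains K where "\<And>t. m < t \<Longrightarrow> t \<noteq> 0 \<Longrightarrow> K * weight t \<in> \<int>"
    "K * weight m = 1 / of_int (\<bar>m\<bar> + 1)"
proof (cases "m < 0")
  case True
  define n where "n = nat (- m)"
  have n: "m = - int n" "n > 0" using True by (auto simp: n_def)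
  show thesis
  \<comment> \<open>The weight of \<open>-n\<close> has denominator \<open>(n+1)!\<close>, whereas
    the denominators at negative positions above it divide \<open>n!\<close>. The sign cancels that
    of \<open>weight m\<close>.\<close>
  proof (rule that[of "(-1) ^ n * fact n"])
    fix t assume t: "m < t" "t \<noteq> 0"
    show "(-1) ^ n * fact n * weight t \<in> \<int>"
    proof (cases "t < 0")
      case True
      have "fact n / fact (nat (- t + 1)) \<in> (\<int> :: rat set)"
        using t True n by (intro fact_div_fact_Ints) auto
      then have "(-1) ^ n * (-1) ^ nat (- t) * (fact n / fact (nat (- t + 1))) \<in> (\<int> :: rat set)"
        by (intro Ints_mult Ints_power) auto
      then show ?thesis using True by (simp add: weight_def mult_ac)
    qed (auto simp: weight_def intro!: Ints_mult Ints_power fact_in_Ints)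
  next
    have "nat (- m + 1) = Suc n" using n by simp
    then have "(-1) ^ n * fact n * weight m = ((-1) ^ n * (-1) ^ n) * (fact n / fact (Suc n))"
      using n \<open>nat (- m + 1) = Suc n\<close> by (simp add: weight_def)
    also have "\<dots> = 1 / of_int (\<bar>m\<bar> + 1)"
      using n fact_div_fact_Suc by (simp del: fact_Suc flip: power_mult_distrib)
    finally show "(-1) ^ n * fact n * weight m = 1 / of_int (\<bar>m\<bar> + 1)" .
  qed
next
  case False
  define n where "n = nat m"
  have n: "m = int n" "n > 0" using False assms by (auto simp: n_def)
  show thesis
  \<comment> \<open>Every factorial at a position above \<open>n\<close> is divisible by
    \<open>(n+1)!\<close>, while \<open>n!\<close> leaves the quotient
    \<open>1/(n+1)\<close>.\<close>
  proof (rule that[of "(-1) ^ Suc n / fact (Suc n)"])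
    fix t assume t: "m < t" "t \<noteq> 0"
    have "fact (nat t) / fact (Suc n) \<in> (\<int> :: rat set)"
      using t n by (intro fact_div_fact_Ints) auto
    then have "(-1) ^ Suc n * (-1) ^ nat (t + 1) * (fact (nat t) / fact (Suc n)) \<in> (\<int> :: rat set)"
      by (intro Ints_mult Ints_power) auto
    then show "(-1) ^ Suc n / fact (Suc n) * weight t \<in> \<int>"
      using t n by (simp add: weight_def mult_ac)
  next
    have "nat (m + 1) = Suc n" using n by simp
    then have "(-1) ^ Suc n / fact (Suc n) * weight m = ((-1) ^ Suc n * (-1) ^ Suc n) * (fact n / fact (Suc n))"
      using n by (simp add: weight_def)
    also have "\<dots> = 1 / of_int (\<bar>m\<bar> + 1)"
      using n fact_div_fact_Suc by (simp del: fact_Suc flip: power_mult_distrib)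
    finally show "(-1) ^ Suc n / fact (Suc n) * weight m = 1 / of_int (\<bar>m\<bar> + 1)" .
  qed
qed

text \<open>
  After scaling, all weights but the one of the least position become integers; this leaves
  \<open>c / (\<bar>m\<bar> + 1)\<close> integral, so the least digit vanishes.
\<close>

lemma digits_eq_zero:
  fixes c :: "int \<Rightarrow> int"
  assumes "finite S" "0 \<notin> S" "\<And>t. t \<in> S \<Longrightarrow> \<bar>c t\<bar> \<le> \<bar>t\<bar>"
    and "(\<Sum>t\<in>S. of_int (c t) * weight t) = 0"
  shows "\<forall>t\<in>S. c t = 0"
  using assms
proof (induction S rule: finite_linorder_min_induct)
  case (insert m S)
  have "m \<noteq> 0" using insert.prems(1) by auto
  then obtain K where K: "\<And>t. m < t \<Longrightarrow> t \<noteq> 0 \<Longrightarrow> K * weight t \<in> \<int>"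
    "K * weight m = 1 / of_int (\<bar>m\<bar> + 1)"
    by (rule weight_scale) blast
  have "m \<notin> S" using insert.hyps by auto
  then have "of_int (c m) * weight m = - (\<Sum>t\<in>S. of_int (c t) * weight t)"
    using insert by (simp add: add_eq_0_iff)
  then have "K * (of_int (c m) * weight m) = - (\<Sum>t\<in>S. K * (of_int (c t) * weight t))"
    by (simp add: sum_distrib_left)
  then have "of_int (c m) * (K * weight m) = - (\<Sum>t\<in>S. of_int (c t) * (K * weight t))"
    by (simp only: mult.left_commute[of K])
  also have "\<dots> \<in> \<int>"
    using insert by (intro Ints_minus Ints_sum Ints_mult K) auto
  finally obtain z where "(of_int (c m) :: rat) / of_int (\<bar>m\<bar> + 1) = of_int z"
    using K(2) by (auto elim: Ints_cases)
  then have "(of_int (c m) :: rat) = of_int (z * (\<bar>m\<bar> + 1))"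
    by (simp add: field_simps)
  then have z: "c m = z * (\<bar>m\<bar> + 1)" by (simp only: of_int_eq_iff)
  \<comment> \<open>\<open>c m\<close> is a multiple of \<open>\<bar>m\<bar> + 1\<close> but too
    small in absolute value to be a nonzero one.\<close>
  have "\<bar>c m\<bar> \<le> \<bar>m\<bar>" using insert.prems by auto
  then have "\<bar>z\<bar> * (\<bar>m\<bar> + 1) < 1 * (\<bar>m\<bar> + 1)" using z by (simp add: abs_mult)
  then have "\<bar>z\<bar> < 1" by (subst (asm) mult_less_cancel_right) auto
  then have "c m = 0" using z by simp
  then show ?case using insert \<open>m \<notin> S\<close> by simp
qed simp

lemma digit_bounds:
  assumes "w \<in> L_tilde"
  shows "0 \<le> digit w t" "digit w t \<le> \<bar>t\<bar>" "digit w t = 0 \<longleftrightarrow> w t = None"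
    "w t = (if digit w t = 0 then None else Some (Num (nat (digit w t))))"
proof -
  have "\<exists>k. w t = Some (Num k) \<and> 1 \<le> k \<and> int k \<le> \<bar>t\<bar>" if "w t \<noteq> None"
    using assms that unfolding L_tilde_def by blast
  then show "0 \<le> digit w t" "digit w t \<le> \<bar>t\<bar>" "digit w t = 0 \<longleftrightarrow> w t = None"
    "w t = (if digit w t = 0 then None else Some (Num (nat (digit w t))))"
    by (cases "w t"; force simp: digit_def)+
qed

text \<open>Digits at \<open>t\<close> lie between 0 and \<open>\<bar>t\<bar>\<close>, so their
  differences meet the bound required by \<open>digits_eq_zero\<close>.\<close>

lemma inj_on_g: "inj_on g L_tilde"
proof (rule inj_onI, rule ext)
  fix w u t assume w: "w \<in> L_tilde" and u: "u \<in> L_tilde" and eq: "g w = g u"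
  let ?S = "dom w \<union> dom u"
  have S: "finite ?S" "0 \<notin> dom w" "0 \<notin> dom u" using w u by (auto simp: L_tilde_def)
  have "(\<Sum>t\<in>?S. of_int (digit w t - digit u t) * weight t) = g w - g u"
    using S g_eq_sum_digit[of ?S w] g_eq_sum_digit[of ?S u]
    by (simp add: left_diff_distrib sum_subtractf)
  then have *: "\<forall>t\<in>?S. digit w t - digit u t = 0"
    using eq digit_bounds(1,2)[OF w] digit_bounds(1,2)[OF u] S
    by (intro digits_eq_zero) (auto simp: abs_le_iff, smt+)
  have "digit w t = digit u t"
  proof (cases "t \<in> ?S")
    case False
    then show ?thesis by (simp add: digit_def domIff)
  qed (use * in auto)
  then show "w t = u t" using digit_bounds(4)[OF w] digit_bounds(4)[OF u] by metis
qed

text \<open>The points \<open>x q\<close> are known to lie in the space only for nonzero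
  \<open>q\<close>.\<close>

lemma g_nonzero:
  assumes "w \<in> L_tilde"
  shows "g w \<noteq> 0"
proof
  assume "g w = 0"
  moreover have w: "finite (dom w)" "0 \<notin> dom w" "dom w \<noteq> {}" using assms by (auto simp: L_tilde_def)
  ultimately have "\<forall>t\<in>dom w. digit w t = 0"
    using digit_bounds(1,2)[OF assms] g_eq_sum_digit[of "dom w" w]
    by (intro digits_eq_zero) auto
  with w(3) digit_bounds(3)[OF assms] show False by auto
qed

lemma g_map_add:
  assumes "finite (dom s)" "finite (dom t)" "0 \<notin> dom s" "0 \<notin> dom t" "dom s \<inter> dom t = {}"
  shows "g (s ++ t) = g s + g t"
proof -
  let ?S = "dom s \<union> dom t"
  have "digit (s ++ t) k = digit s k + digit t k" for k
    using assms(5) by (auto simp: digit_def map_add_def disjoint_iff domIff split: option.splits)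
  moreover have "g (s ++ t) = (\<Sum>k\<in>?S. of_int (digit (s ++ t) k) * weight k)"
    using assms by (intro g_eq_sum_digit) auto
  moreover have "g s = (\<Sum>k\<in>?S. of_int (digit s k) * weight k)"
    using assms by (intro g_eq_sum_digit) auto
  moreover have "g t = (\<Sum>k\<in>?S. of_int (digit t k) * weight k)"
    using assms by (intro g_eq_sum_digit) auto
  ultimately show ?thesis
    by (simp add: distrib_right sum.distrib)
qed

subsection \<open>Words and their spans\<close>

lemma dom_subst_word [simp]: "dom (subst_word w ab) = dom w"
  by (auto simp: subst_word_def split: if_splits)

lemma subst_word_map_add: "subst_word (s ++ t) ab = subst_word s ab ++ subst_word t ab"
  by (auto simp: subst_word_def map_add_def fun_eq_iff split: option.splits)

lemma subst_word_Upsilon [simp]: "subst_word w (Upsilon, Upsilon) = w"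
  by (auto simp: subst_word_def)

lemma subst_word_Num [simp]: "subst_word (subst_word w (Num a, Num b)) cd = subst_word w (Num a, Num b)"
  by (auto simp: subst_word_def)

lemma subst_word_in_L_tilde:
  assumes "w \<in> L0_var" "1 \<le> a" "1 \<le> b" "\<And>t. t \<in> dom w \<Longrightarrow> int a \<le> \<bar>t\<bar> \<and> int b \<le> \<bar>t\<bar>"
  shows "subst_word w (Num a, Num b) \<in> L_tilde"
proof -
  have "\<exists>k. subst_word w (Num a, Num b) t = Some (Num k) \<and> 1 \<le> k \<and> int k \<le> \<bar>t\<bar>"
    if "t \<in> dom w" for t
  proof (cases "w t = Some Upsilon")
    case True
    then show ?thesis using assms(2,3) assms(4)[OF that] by (auto simp: subst_word_def)
  next
    case False
    moreover have "\<forall>t\<in>dom w. w t = Some Upsilon \<or> (\<exists>k. w t = Some (Num k) \<and> 1 \<le> k \<and> int k \<le> \<bar>t\<bar>)"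
      using assms(1) by (simp add: L0_var_def)
    ultimately show ?thesis using that by (auto simp: subst_word_def)
  qed
  then show ?thesis
    using assms(1) by (simp add: L_tilde_def L0_var_def del: dom_eq_empty_conv)
qed

lemma map_add_in_L_tilde:
  assumes "s \<in> L_tilde" "t \<in> L_tilde"
  shows "s ++ t \<in> L_tilde"
proof -
  have "\<exists>k. (s ++ t) x = Some (Num k) \<and> 1 \<le> k \<and> int k \<le> \<bar>x\<bar>" if "x \<in> dom s \<union> dom t" for x
  proof (cases "x \<in> dom t")
    case True
    then show ?thesis using assms(2) by (simp add: L_tilde_def map_add_dom_app_simps)
  next
    case False
    with that show ?thesis using assms(1) by (simp add: L_tilde_def map_add_dom_app_simps)
  qed
  then show ?thesis using assms by (auto simp: L_tilde_def)
qed

text \<open>A pointwise form of \<open>less_R1\<close>, splitting \<open>dom u\<close> by sign and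
  avoiding \<open>Min\<close> and \<open>Max\<close>.\<close>

definition nested :: "word \<Rightarrow> word \<Rightarrow> bool" where
  "nested w u \<longleftrightarrow> (\<forall>s\<in>dom w. \<forall>t\<in>dom u. (t < 0 \<longrightarrow> t < s) \<and> (t > 0 \<longrightarrow> s < t))"

lemma L0_var_signs:
  assumes "w \<in> L0_var"
  obtains r t where "r \<in> dom w" "r < 0" "t \<in> dom w" "0 < t"
  using assms by (auto simp: L0_var_def dom_neg_def dom_pos_def)

text \<open>Since \<open>w\<close> has positions of both signs, \<open>A1\<close> must be negative
  and \<open>A2\<close> positive. Conversely the sign parts of \<open>u\<close> serve as
  \<open>A1\<close> and \<open>A2\<close>.\<close>

lemma less_R1_iff_nested:
  assumes "w \<in> L0_var" "u \<in> L0_var"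
  shows "less_R1 w u \<longleftrightarrow> nested w u"
proof
  have fin: "finite (dom w)" "finite (dom u)" using assms by (auto simp: L0_var_def)
  obtain r t where w: "r \<in> dom w" "r < 0" "t \<in> dom w" "0 < t" using L0_var_signs[OF assms(1)] .
  obtain r' t' where u: "r' \<in> dom u" "r' < 0" "t' \<in> dom u" "0 < t'" using L0_var_signs[OF assms(2)] .
  {
    assume "less_R1 w u"
    then obtain A1 A2 where A: "dom u = A1 \<union> A2" "Max A1 < Min (dom w)" "Max (dom w) < Min A2"
      unfolding less_R1_def by blast
    have finA: "finite A1" "finite A2" using fin A(1) by (auto intro: finite_subset)
    have "a < s" if "a \<in> A1" "s \<in> dom w" for a s
      using that A(2) finA fin by (meson Max_ge Min_le order.strict_trans1 order.strict_trans2)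
    moreover have "s < a" if "a \<in> A2" "s \<in> dom w" for a s
      using that A(3) finA fin by (meson Max_ge Min_le order.strict_trans1 order.strict_trans2)
    ultimately show "nested w u"
      unfolding nested_def A(1) using w by (metis Un_iff not_less_iff_gr_or_eq order.strict_trans)
  }
  assume n: "nested w u"
  have "dom u = dom_neg u \<union> dom_pos u"
    using assms(2) by (auto simp: L0_var_def dom_neg_def dom_pos_def not_less intro: order.antisym)
  moreover have ne: "dom_neg u \<noteq> {}" "dom_pos u \<noteq> {}" using u by (auto simp: dom_neg_def dom_pos_def)
  moreover have "finite (dom_neg u)" "finite (dom_pos u)" "dom w \<noteq> {}"
    using fin w by (auto simp: dom_neg_def dom_pos_def)
  moreover from this have "Max (dom_neg u) < Min (dom w)" "Max (dom w) < Min (dom_pos u)"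
    using n fin ne by (auto simp: nested_def dom_neg_def dom_pos_def)
  moreover have "Min (dom w) \<le> Max (dom w)" using fin w by (meson Max_ge Min_le order_trans)
  ultimately show "less_R1 w u" unfolding less_R1_def by blast
qed

lemma nested_trans:
  assumes "nested w u" "nested u v" "u \<in> L0_var"
  shows "nested w v"
  using assms(1,2) L0_var_signs[OF assms(3)] unfolding nested_def
  by (metis order.strict_trans)

lemma nested_disjoint: "nested w u \<Longrightarrow> 0 \<notin> dom u \<Longrightarrow> dom w \<inter> dom u = {}"
  unfolding nested_def by (metis disjoint_iff linorder_neqE order.irrefl)

lemma Q_inf_nested:
  assumes "w \<in> Q_inf" "1 \<le> m" "m < n"
  shows "nested (w m) (w n)"
  using assms(3,2)
proof (induction rule: less_Suc_induct)
  case (1 i)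
  then show ?case using assms(1) less_R1_iff_nested[of "w i" "w (Suc i)"] by (auto simp: Q_inf_def)
next
  case (2 i j k)
  then show ?case using assms(1) by (auto simp: Q_inf_def intro: nested_trans)
qed

text \<open>Nesting pushes the positions outwards by at least one at each step. Hence letters up to
  \<open>n\<close> are allowed everywhere in \<open>w n\<close>.\<close>

lemma Q_inf_dom_ge:
  assumes "w \<in> Q_inf" "1 \<le> n"
  shows "t \<in> dom (w n) \<Longrightarrow> int n \<le> \<bar>t\<bar>"
  using assms(2)
proof (induction n arbitrary: t rule: nat_induct_at_least)
  case base
  then have "t \<noteq> 0" using assms(1) by (auto simp: Q_inf_def L0_var_def)
  then show ?case by simp
next
  case (Suc n)
  have "w n \<in> L0_var" "t \<noteq> 0" using assms(1) Suc by (auto simp: Q_inf_def L0_var_def)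
  obtain r s where rs: "r \<in> dom (w n)" "r < 0" "s \<in> dom (w n)" "0 < s"
    using L0_var_signs[OF \<open>w n \<in> L0_var\<close>] .
  have "nested (w n) (w (Suc n))" using Q_inf_nested[OF assms(1) Suc.hyps] by simp
  then have "t < 0 \<longrightarrow> t < r" "t > 0 \<longrightarrow> s < t" using rs Suc.prems by (auto simp: nested_def)
  then show ?case using Suc.IH[OF rs(1)] Suc.IH[OF rs(3)] rs \<open>t \<noteq> 0\<close> by linarith
qed


section \<open>Concatenations of instances and their spans\<close>

definition pairs :: "nat \<Rightarrow> (letter \<times> letter) set" where
  "pairs m = {(Num a, Num b) | a b. a \<in> {1..m} \<and> b \<in> {1..m}}"

definition concat_words :: "(nat \<Rightarrow> word) \<Rightarrow> nat list \<Rightarrow> (nat \<Rightarrow> letter \<times> letter) \<Rightarrow> word" where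
  "concat_words w ns ab = foldr (++) (map (\<lambda>m. subst_word (w m) (ab m)) ns) Map.empty"

text \<open>The flag \<open>v\<close> tells whether the variable survives in the concatenation.\<close>

definition span_words :: "(nat \<Rightarrow> word) \<Rightarrow> bool \<Rightarrow> nat \<Rightarrow> word set" where
  "span_words w v n = {concat_words w ns ab | ns ab. ns \<noteq> [] \<and> sorted_wrt (<) ns \<and>
     (\<forall>m\<in>set ns. n \<le> m \<and> 1 \<le> m \<and> ab m \<in> pairs m \<union> {(Upsilon, Upsilon)}) \<and>
     (v \<longleftrightarrow> (\<exists>m\<in>set ns. ab m = (Upsilon, Upsilon)))}"

lemma concat_words_append:
  "concat_words w (ns @ ms) ab = concat_words w ns ab ++ concat_words w ms ab"
  by (induction ns) (simp_all add: concat_words_def)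

lemma concat_words_cong:
  "(\<And>m. m \<in> set ns \<Longrightarrow> ab m = ab' m) \<Longrightarrow> concat_words w ns ab = concat_words w ns ab'"
  unfolding concat_words_def by (rule arg_cong[where f = "\<lambda>l. foldr (++) l Map.empty"]) simp

lemma dom_concat_words: "dom (concat_words w ns ab) = (\<Union>m\<in>set ns. dom (w m))"
  by (induction ns) (auto simp: concat_words_def)

text \<open>Map addition lets later words overwrite earlier ones, so \<open>t\<close> must belong to
  only one word of the list.\<close>

lemma concat_words_apply:
  assumes "m \<in> set ns" "t \<in> dom (w m)"
    and "\<And>k. k \<in> set ns \<Longrightarrow> t \<in> dom (w k) \<Longrightarrow> k = m"
  shows "concat_words w ns ab t = subst_word (w m) (ab m) t"
  using assms
proof (induction ns)
  case (Cons k ns)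
  have split: "concat_words w (k # ns) ab = subst_word (w k) (ab k) ++ concat_words w ns ab"
    by (simp add: concat_words_def)
  show ?case
  proof (cases "m \<in> set ns")
    case True
    then have "t \<in> dom (concat_words w ns ab)" using Cons.prems(2) by (auto simp: dom_concat_words)
    moreover have "concat_words w ns ab t = subst_word (w m) (ab m) t"
      using True Cons.prems by (intro Cons.IH) auto
    ultimately show ?thesis by (simp add: split map_add_dom_app_simps)
  next
    case False
    then have "m = k" "t \<notin> dom (concat_words w ns ab)"
      using Cons.prems by (auto simp: dom_concat_words)
    then show ?thesis by (simp add: split map_add_dom_app_simps)
  qed
qed simp

text \<open>Factors already instantiated by numbers contain no variable any more, so only the
  surviving ones change.\<close>

lemma subst_concat_words:
  assumes "\<And>m. m \<in> set ns \<Longrightarrow> ab m \<in> pairs m \<union> {(Upsilon, Upsilon)}"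
  shows "subst_word (concat_words w ns ab) c =
    concat_words w ns (\<lambda>m. if ab m = (Upsilon, Upsilon) then c else ab m)"
  using assms
proof (induction ns)
  case Nil
  then show ?case by (simp add: concat_words_def subst_word_def)
next
  case (Cons k ns)
  have split: "concat_words w (k # ns) ab = subst_word (w k) (ab k) ++ concat_words w ns ab" for ab
    by (simp add: concat_words_def)
  have "subst_word (subst_word (w k) (ab k)) c =
      subst_word (w k) (if ab k = (Upsilon, Upsilon) then c else ab k)"
    using Cons.prems[of k] by (auto simp: pairs_def)
  with Cons show ?case by (simp add: split subst_word_map_add)
qed

lemma span_words_antimono: "n \<le> n' \<Longrightarrow> span_words w v n' \<subseteq> span_words w v n"
  unfolding span_words_def by (blast intro: order_trans)

lemma span_words_not_empty: "span_words w v n \<noteq> {}"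
proof -
  let ?ab = "\<lambda>_::nat. if v then (Upsilon, Upsilon) else (Num 1, Num 1)"
  have "concat_words w [max 1 n] ?ab \<in> span_words w v n"
    unfolding span_words_def
    by (intro CollectI exI[of _ "[max 1 n]"] exI[of _ ?ab]) (auto simp: pairs_def)
  then show ?thesis by blast
qed

text \<open>\<open>s\<close> uses finitely many indices; beyond them the concatenated index list is
  still increasing. The bound \<open>k\<close> depends on \<open>s\<close>, as the product of
  filters permits.\<close>

lemma span_words_map_add:
  assumes "s \<in> span_words w v n"
  obtains k where "\<And>v' t. t \<in> span_words w v' k \<Longrightarrow> s ++ t \<in> span_words w (v \<or> v') n"
proof -
  obtain ns ab where s: "s = concat_words w ns ab" "ns \<noteq> []" "sorted_wrt (<) ns"
    "\<And>m. m \<in> set ns \<Longrightarrow> n \<le> m \<and> 1 \<le> m \<and> ab m \<in> pairs m \<union> {(Upsilon, Upsilon)}"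
    "v \<longleftrightarrow> (\<exists>m\<in>set ns. ab m = (Upsilon, Upsilon))"
    using assms by (auto simp: span_words_def)
  define k where "k = Suc (max n (Max (set ns)))"
  have "n \<le> k" by (simp add: k_def)
  have lt: "m < k" if "m \<in> set ns" for m
    using Max_ge[OF _ that] by (simp add: k_def)
  show thesis
  proof (rule that)
    fix v' t assume "t \<in> span_words w v' k"
    then obtain ms cd where t: "t = concat_words w ms cd" "ms \<noteq> []" "sorted_wrt (<) ms"
      "\<And>m. m \<in> set ms \<Longrightarrow> k \<le> m \<and> 1 \<le> m \<and> cd m \<in> pairs m \<union> {(Upsilon, Upsilon)}"
      "v' \<longleftrightarrow> (\<exists>m\<in>set ms. cd m = (Upsilon, Upsilon))"
      by (auto simp: span_words_def)
    define e where "e m = (if m < k then ab m else cd m)" for m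
    have e: "e m = ab m" if "m \<in> set ns" for m using lt[OF that] by (simp add: e_def)
    have e': "e m = cd m" if "m \<in> set ms" for m using t(4)[OF that] by (simp add: e_def)
    have "s ++ t = concat_words w (ns @ ms) e"
      unfolding concat_words_append s t using concat_words_cong[of ns e ab w] concat_words_cong[of ms e cd w]
      by (simp add: e e')
    moreover have "sorted_wrt (<) (ns @ ms)"
      using s(3) t(3,4) lt by (force simp: sorted_wrt_append)
    moreover have "n \<le> m \<and> 1 \<le> m \<and> e m \<in> pairs m \<union> {(Upsilon, Upsilon)}" if "m \<in> set (ns @ ms)" for m
    proof (cases "m \<in> set ns")
      case True
      then show ?thesis using s(4) e by simp
    next
      case False
      then have "m \<in> set ms" using that by simp
      then show ?thesis using t(4)[of m] e'[of m] \<open>n \<le> k\<close> by simp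
    qed
    moreover have "v \<or> v' \<longleftrightarrow> (\<exists>m\<in>set (ns @ ms). e m = (Upsilon, Upsilon))"
      using s(5) t(5) e e' by (simp add: bex_Un)
    ultimately show "s ++ t \<in> span_words w (v \<or> v') n"
      using s(2) unfolding span_words_def by (intro CollectI exI[of _ "ns @ ms"] exI[of _ e]) simp
  qed
qed

lemma subst_word_const_span:
  assumes "s \<in> span_words w False n"
  shows "subst_word s c = s"
proof -
  obtain ns ab where s: "s = concat_words w ns ab"
    "\<And>m. m \<in> set ns \<Longrightarrow> ab m \<in> pairs m \<and> ab m \<noteq> (Upsilon, Upsilon)"
    using assms by (auto simp: span_words_def)
  then show ?thesis
    using concat_words_cong[of ns "\<lambda>m. if ab m = (Upsilon, Upsilon) then c else ab m" ab w]
    by (simp add: subst_concat_words)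
qed

text \<open>All indices are at least \<open>n\<close>, so letters up to \<open>n\<close> are
  legitimate for each surviving factor.\<close>

lemma subst_word_var_span:
  assumes "s \<in> span_words w v n" "1 \<le> a" "1 \<le> b" "a \<le> n" "b \<le> n"
  shows "subst_word s (Num a, Num b) \<in> span_words w False n"
proof -
  obtain ns ab where s: "s = concat_words w ns ab" "ns \<noteq> []" "sorted_wrt (<) ns"
    "\<And>m. m \<in> set ns \<Longrightarrow> n \<le> m \<and> 1 \<le> m \<and> ab m \<in> pairs m \<union> {(Upsilon, Upsilon)}"
    using assms by (auto simp: span_words_def)
  let ?e = "\<lambda>m. if ab m = (Upsilon, Upsilon) then (Num a, Num b) else ab m"
  have "n \<le> m \<and> 1 \<le> m \<and> ?e m \<in> pairs m" if "m \<in> set ns" for m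
    using s(4)[OF that] assms by (auto simp: pairs_def)
  moreover have "?e m \<noteq> (Upsilon, Upsilon)" for m by simp
  moreover have "subst_word s (Num a, Num b) = concat_words w ns ?e"
    using s by (simp add: subst_concat_words)
  ultimately show ?thesis
    using s(2,3) unfolding span_words_def by blast
qed

context
  fixes w :: "nat \<Rightarrow> word"
  assumes w: "w \<in> Q_inf"
begin

lemma concat_words_apply':
  assumes "sorted_wrt (<) ns" "\<And>m. m \<in> set ns \<Longrightarrow> 1 \<le> m" "m \<in> set ns" "t \<in> dom (w m)"
  shows "concat_words w ns ab t = subst_word (w m) (ab m) t"
proof (rule concat_words_apply[of m ns t w, OF assms(3,4)])
  fix k assume k: "k \<in> set ns" "t \<in> dom (w k)"
  have *: "dom (w i) \<inter> dom (w j) = {}" if "1 \<le> i" "i < j" for i j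
    using Q_inf_nested[OF w that] w that by (intro nested_disjoint) (auto simp: Q_inf_def L0_var_def)
  show "k = m"
    using *[of k m] *[of m k] assms(2)[OF k(1)] assms(2,3,4) k(2) by (cases k m rule: linorder_cases) auto
qed

text \<open>A position of \<open>w m\<close> has absolute value at least \<open>m\<close>, which
  bounds the letters substituted there.\<close>

lemma span_words_letters:
  assumes "s \<in> span_words w v n"
  shows "finite (dom s)" "dom s \<noteq> {}" "0 \<notin> dom s"
    "t \<in> dom s \<Longrightarrow> v \<and> s t = Some Upsilon \<or> (\<exists>k. s t = Some (Num k) \<and> 1 \<le> k \<and> int k \<le> \<bar>t\<bar>)"
    "v \<Longrightarrow> (\<exists>t\<in>dom_neg s. s t = Some Upsilon) \<and> (\<exists>t\<in>dom_pos s. s t = Some Upsilon)"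
proof -
  obtain ns ab where s: "s = concat_words w ns ab" "ns \<noteq> []" "sorted_wrt (<) ns"
    "\<And>m. m \<in> set ns \<Longrightarrow> n \<le> m \<and> 1 \<le> m \<and> ab m \<in> pairs m \<union> {(Upsilon, Upsilon)}"
    "v \<longleftrightarrow> (\<exists>m\<in>set ns. ab m = (Upsilon, Upsilon))"
    using assms by (auto simp: span_words_def)
  have L0: "w m \<in> L0_var" if "m \<in> set ns" for m
    using s(4)[OF that] w by (auto simp: Q_inf_def)
  have dom: "dom s = (\<Union>m\<in>set ns. dom (w m))" by (simp add: s(1) dom_concat_words)
  have app: "s t = subst_word (w m) (ab m) t" if "m \<in> set ns" "t \<in> dom (w m)" for m t
    unfolding s(1) using concat_words_apply'[OF s(3) _ that] s(4) by blast
  show "finite (dom s)" "0 \<notin> dom s" using L0 by (auto simp: dom L0_var_def)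
  have "dom (w (hd ns)) \<noteq> {}" using L0[of "hd ns"] s(2) by (simp add: L0_var_def)
  then show "dom s \<noteq> {}" using s(2) hd_in_set[of ns] unfolding dom by blast
  show "v \<and> s t = Some Upsilon \<or> (\<exists>k. s t = Some (Num k) \<and> 1 \<le> k \<and> int k \<le> \<bar>t\<bar>)"
    if "t \<in> dom s"
  proof -
    obtain m where m: "m \<in> set ns" "t \<in> dom (w m)" using \<open>t \<in> dom s\<close> unfolding dom by blast
    have "int m \<le> \<bar>t\<bar>" using Q_inf_dom_ge[OF w _ m(2)] s(4)[OF m(1)] by blast
    moreover have "w m t = Some Upsilon \<or> (\<exists>k. w m t = Some (Num k) \<and> 1 \<le> k \<and> int k \<le> \<bar>t\<bar>)"
      using L0[OF m(1)] m(2) by (simp add: L0_var_def)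
    moreover have "v" if "ab m = (Upsilon, Upsilon)" using s(5) m(1) that by blast
    ultimately show ?thesis
      using app[OF m] s(4)[OF m(1)] by (auto simp: subst_word_def pairs_def)
  qed
  show "(\<exists>t\<in>dom_neg s. s t = Some Upsilon) \<and> (\<exists>t\<in>dom_pos s. s t = Some Upsilon)" if v
  proof -
    obtain m where m: "m \<in> set ns" "ab m = (Upsilon, Upsilon)" using s(5) \<open>v\<close> by blast
    have "t \<in> dom s \<and> s t = Some Upsilon" if "w m t = Some Upsilon" for t
      using app[OF m(1), of t] m(2) that by auto
    moreover have "(\<exists>t\<in>dom_neg (w m). w m t = Some Upsilon) \<and> (\<exists>t\<in>dom_pos (w m). w m t = Some Upsilon)"
      using L0[OF m(1)] by (simp add: L0_var_def)
    ultimately show ?thesis unfolding dom_neg_def dom_pos_def by blast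
  qed
qed

lemma const_span_in_L_tilde: "s \<in> span_words w False n \<Longrightarrow> s \<in> L_tilde"
  using span_words_letters[of s False n] by (auto simp: L_tilde_def)

lemma var_span_in_L0_var: "s \<in> span_words w True n \<Longrightarrow> s \<in> L0_var"
  using span_words_letters[of s True n] by (auto simp: L0_var_def)

lemma var_span_less_R1:
  assumes "s \<in> span_words w True n"
  obtains k where "\<And>t. t \<in> span_words w True k \<Longrightarrow> less_R1 s t"
proof -
  obtain ns ab where s: "s = concat_words w ns ab" "\<And>m. m \<in> set ns \<Longrightarrow> 1 \<le> m"
    using assms by (auto simp: span_words_def)
  show thesis
  proof (rule that)
    \<comment> \<open>Starting beyond the largest index of \<open>s\<close> makes each factor of
      \<open>t\<close> enclose each factor of \<open>s\<close>.\<close>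
    fix t assume t: "t \<in> span_words w True (Suc (Max (set ns)))"
    then obtain ms cd where ms: "t = concat_words w ms cd" "\<And>m. m \<in> set ms \<Longrightarrow> Suc (Max (set ns)) \<le> m"
      by (auto simp: span_words_def)
    have "nested (w m) (w k)" if "m \<in> set ns" "k \<in> set ms" for m k
      using Q_inf_nested[OF w s(2)[OF that(1)]] ms(2)[OF that(2)] Max_ge[OF _ that(1)] by simp
    then have "nested s t" unfolding s ms nested_def dom_concat_words by blast
    then show "less_R1 s t"
      using less_R1_iff_nested var_span_in_L0_var[OF assms] var_span_in_L0_var[OF t] by simp
  qed
qed

end

subsection \<open>Extractions homogeneous along an ultrafilter\<close>

text \<open>It stands for the closed set of ultrafilters concentrated on concatenations with
  arbitrarily large least index.\<close>

definition span_filter :: "(nat \<Rightarrow> word) \<Rightarrow> bool \<Rightarrow> word filter" where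
  "span_filter w v = (INF n. principal (span_words w v n))"

lemma eventually_span_filter:
  "eventually P (span_filter w v) \<longleftrightarrow> (\<exists>n. \<forall>s\<in>span_words w v n. P s)"
  unfolding span_filter_def
proof (subst eventually_INF_base)
  fix m n :: nat
  show "\<exists>k\<in>UNIV. principal (span_words w v k)
      \<le> inf (principal (span_words w v m)) (principal (span_words w v n))"
    by (intro bexI[of _ "max m n"]) (simp_all add: span_words_antimono)
qed (auto simp: eventually_principal)

lemma span_filter_not_bot: "span_filter w v \<noteq> bot"
  using span_words_not_empty[of w v] by (auto simp: trivial_limit_def eventually_span_filter ex_in_conv)

interpretation words: semigroup "(++) :: word \<Rightarrow> word \<Rightarrow> word"
  by standard simp

lemma span_filter_mult: "words.filter_mult (span_filter w v) (span_filter w v') \<le> span_filter w (v \<or> v')"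
  unfolding le_filter_def
proof (intro allI impI)
  fix P assume "eventually P (span_filter w (v \<or> v'))"
  then obtain n where n: "\<And>s. s \<in> span_words w (v \<or> v') n \<Longrightarrow> P s"
    by (auto simp: eventually_span_filter)
  have "\<exists>k. \<forall>t\<in>span_words w v' k. P (s ++ t)" if "s \<in> span_words w v n" for s
    using span_words_map_add[OF that] n by metis
  then show "eventually P (words.filter_mult (span_filter w v) (span_filter w v'))"
    unfolding words.eventually_filter_mult eventually_span_filter by blast
qed

text \<open>\<open>A n\<close> is meant to contain every instantiated concatenation with least index
  \<open>n\<close>; the last clause allows one more instance to be put in front.\<close>

definition homogeneous :: "(nat \<Rightarrow> word) \<Rightarrow> (nat \<Rightarrow> word \<Rightarrow> bool) \<Rightarrow> bool" where
  "homogeneous u A \<longleftrightarrow> (\<forall>n s. A (Suc n) s \<longrightarrow> A n s) \<and>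
    (\<forall>n. \<forall>a\<in>{1..n}. \<forall>b\<in>{1..n}. A n (subst_word (u n) (Num a, Num b)) \<and>
      (\<forall>s. A (Suc n) s \<longrightarrow> A n (subst_word (u n) (Num a, Num b) ++ s)))"

text \<open>\<open>x0\<close> depends only on the ultrafilter \<open>p\<close>, so the
  neighbourhoods \<open>V n\<close> can be chosen after it.\<close>

lemma homogeneous_extraction_exists:
  assumes w: "w \<in> Q_inf" and T: "compact_space T" 
    and f: "\<And>s. s \<in> L_tilde \<Longrightarrow> f s \<in> topspace T"
  obtains x0 where "x0 \<in> topspace T"
    "\<And>V. (\<And>n::nat. openin T (V n) \<and> x0 \<in> V n) \<Longrightarrow> \<exists>u A.
      (\<forall>n. u n \<in> span_words w True 1) \<and> (\<forall>n. less_R1 (u n) (u (Suc n))) \<and>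
      homogeneous u A \<and> (\<forall>n s. A n s \<longrightarrow> f s \<in> V n)"
proof -
  let ?C = "span_filter w False" and ?V = "span_filter w True"
  let ?T = "\<lambda>(a, b) s. subst_word s (Num a, Num b)"
  let ?I = "{1..} \<times> {1::nat..}"
  obtain p q where p: "ultra p" "p \<le> ?C" "words.filter_mult p p = p"
    and q: "q \<noteq> bot" "q \<le> ?V" "\<And>i. i \<in> ?I \<Longrightarrow> filtermap (?T i) q = p"
  proof (rule words.variable_ultrafilter_exists[of ?C ?V ?T ?I])
    show "words.filter_mult ?C ?C \<le> ?C" "words.filter_mult ?C ?V \<le> ?V"
      "words.filter_mult ?V ?C \<le> ?V" "words.filter_mult ?V ?V \<le> ?V"
      using span_filter_mult[of w False False] span_filter_mult[of w False True]
        span_filter_mult[of w True False] span_filter_mult[of w True True] by simp_all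
    show "?T i (s ++ t) = ?T i s ++ ?T i t" for i :: "nat \<times> nat" and s t
      by (simp add: subst_word_map_add case_prod_beta)
    show "eventually (\<lambda>s. ?T i s = s) ?C" for i :: "nat \<times> nat"
      unfolding eventually_span_filter
      by (intro exI[of _ 0]) (simp add: subst_word_const_span case_prod_beta)
    fix i :: "nat \<times> nat" assume i: "i \<in> ?I"
    show "filtermap (?T i) ?V \<le> ?C"
      unfolding le_filter_def eventually_filtermap eventually_span_filter
    proof (intro allI impI)
      fix P assume "\<exists>n. \<forall>s\<in>span_words w False n. P s"
      then obtain n where n: "\<And>s. s \<in> span_words w False n \<Longrightarrow> P s" by blast
      \<comment> \<open>Indices from \<open>m\<close> on admit both letters of \<open>i\<close>, so
        the substituted words stay in the span.\<close>
      define m where "m = max n (max (fst i) (snd i))"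
      have "P (?T i s)" if "s \<in> span_words w True m" for s
      proof -
        have "?T i s \<in> span_words w False m"
          using subst_word_var_span[OF that, of "fst i" "snd i"] i by (auto simp: m_def)
        then show ?thesis
          using n span_words_antimono[of n m w False] by (auto simp: m_def)
      qed
      then show "\<exists>n. \<forall>s\<in>span_words w True n. P (?T i s)" by blast
    qed
  qed (simp_all add: span_filter_not_bot)
  have "eventually (\<lambda>s. f s \<in> topspace T) ?C"
    unfolding eventually_span_filter using f const_span_in_L_tilde[OF w] by blast
  then have "eventually (\<lambda>s. f s \<in> topspace T) p" using p(2) by (simp add: le_filter_def)
  then obtain x0 where x0: "x0 \<in> topspace T"
    "\<And>V. openin T V \<Longrightarrow> x0 \<in> V \<Longrightarrow> eventually (\<lambda>s. f s \<in> V) p"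
    using compact_space_ultra_limit[OF T p(1)] by metis
  have q': "eventually P q" if "eventually P ?V" for P
    using that q(2) by (simp add: le_filter_def)
  have D: "eventually (\<lambda>u. u \<in> span_words w True 1) q"
    by (rule q') (auto simp: eventually_span_filter)
  have R: "eventually (less_R1 u) q" if u: "u \<in> span_words w True 1" for u
    by (rule q', unfold eventually_span_filter) (use var_span_less_R1[OF w u] in metis)
  show thesis
  proof (rule that[OF x0(1)])
    fix V assume V: "\<And>n::nat. openin T (V n) \<and> x0 \<in> V n"
    \<comment> \<open>At stage \<open>n\<close> only the finitely many pairs of letters up to
      \<open>n\<close> must be respected.\<close>
    obtain u A where "\<And>n. u n \<in> span_words w True 1" "\<And>n. less_R1 (u n) (u (Suc n))"
      "\<And>n s. A n s \<Longrightarrow> f s \<in> V n" "\<And>n s. A (Suc n) s \<Longrightarrow> A n s"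
      "\<And>n i. i \<in> {1..n} \<times> {1..n} \<Longrightarrow> A n (?T i (u n))"
      "\<And>n i s. i \<in> {1..n} \<times> {1..n} \<Longrightarrow> A (Suc n) s \<Longrightarrow> A n (?T i (u n) ++ s)"
      by (rule words.homogeneous_sequence_exists
          [of p q "\<lambda>n. {1..n} \<times> {1..n}" ?T "\<lambda>n s. f s \<in> V n" "\<lambda>u. u \<in> span_words w True 1" less_R1])
        (use p q V x0(2) D R in \<open>auto\<close>)
    then show "\<exists>u A.
      (\<forall>n. u n \<in> span_words w True 1) \<and> (\<forall>n. less_R1 (u n) (u (Suc n))) \<and>
      homogeneous u A \<and> (\<forall>n s. A n s \<longrightarrow> f s \<in> V n)"
      by (intro exI[of _ u] exI[of _ A]) (auto simp: homogeneous_def)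
  qed
qed

section \<open>Finite sums and the uniform limit\<close>

lemma is_extraction_span:
  assumes "w \<in> Q_inf" "\<And>n. u n \<in> span_words w True 1" "\<And>n. less_R1 (u n) (u (Suc n))"
  shows "is_extraction u w"
  unfolding is_extraction_def
proof (intro conjI allI impI)
  show "u \<in> Q_inf" using var_span_in_L0_var[OF assms(1,2)] assms(3) by (simp add: Q_inf_def)
  fix n
  show "\<exists>ns ab. ns \<noteq> [] \<and> sorted_wrt (<) ns \<and> (\<forall>m\<in>set ns. 1 \<le> m) \<and>
      (\<forall>m\<in>set ns. ab m \<in> {(Num a, Num b) | a b. a \<in> {1..m} \<and> b \<in> {1..m}} \<union> {(Upsilon, Upsilon)}) \<and>
      (\<exists>m\<in>set ns. ab m = (Upsilon, Upsilon)) \<and>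
      u n = foldr (++) (map (\<lambda>m. subst_word (w m) (ab m)) ns) Map.empty"
    using assms(2)[of n] unfolding span_words_def concat_words_def pairs_def by blast
qed

text \<open>Peeling off the least index works because \<open>A\<close> is decreasing.\<close>

lemma finite_sum_word:
  assumes u: "u \<in> Q_inf" and ij: "admissible i j"
    and hom: "homogeneous u A"
    and F: "finite F" "F \<noteq> {}" "F \<subseteq> {1..}"
  shows "\<exists>s\<in>L_tilde. A (Min F) s \<and> dom s = (\<Union>n\<in>F. dom (u n)) \<and>
    g s = (\<Sum>n\<in>F. g_var (u n) (i n) (j n))"
  using F
proof (induction F rule: finite_linorder_min_induct)
  case (insert b F)
  \<comment> \<open>The order is swapped as in \<open>g_var\<close>: \<open>j\<close> goes to the
    positive positions and \<open>i\<close> to the negative ones.\<close>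
  let ?c = "subst_word (u b) (Num (j b), Num (i b))"
  have b: "1 \<le> b" using insert.prems by simp
  then have ij_b: "j b \<in> {1..b}" "i b \<in> {1..b}" using ij by (auto simp: admissible_def)
  have c: "?c \<in> L_tilde"
  proof (rule subst_word_in_L_tilde)
    show "u b \<in> L0_var" using u b by (simp add: Q_inf_def)
    show "int (j b) \<le> \<bar>t\<bar> \<and> int (i b) \<le> \<bar>t\<bar>" if "t \<in> dom (u b)" for t
      using Q_inf_dom_ge[OF u b that] ij_b by simp
  qed (use ij_b in auto)
  show ?case
  proof (cases "F = {}")
    case True
    then show ?thesis using c hom ij_b by (intro bexI[of _ ?c]) (auto simp: g_var_def homogeneous_def)
  next
    case False
    then obtain s where s: "s \<in> L_tilde" "A (Min F) s" "dom s = (\<Union>n\<in>F. dom (u n))"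
      "g s = (\<Sum>n\<in>F. g_var (u n) (i n) (j n))"
      using insert by auto
    have "Suc b \<le> Min F" using insert.hyps False by (simp add: Suc_le_eq)
    then have "A (Suc b) s"
      using s(2) by (induction rule: inc_induct) (use hom in \<open>auto simp: homogeneous_def\<close>)
    then have "A b (?c ++ s)" using hom ij_b unfolding homogeneous_def by blast
    moreover have Min: "Min (insert b F) = b"
      using insert.hyps by (intro Min_eqI) (auto simp: less_imp_le)
    moreover have "dom ?c \<inter> dom s = {}"
    proof -
      have "dom (u b) \<inter> dom (u n) = {}" if "n \<in> F" for n
      proof (rule nested_disjoint)
        show "nested (u b) (u n)" using Q_inf_nested[OF u b] insert.hyps that by blast
        show "0 \<notin> dom (u n)" using u that insert.prems by (auto simp: Q_inf_def L0_var_def)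
      qed
      then show ?thesis by (simp only: dom_subst_word s(3)) blast
    qed
    moreover from this have "g (?c ++ s) = g ?c + g s"
      using c s(1) by (intro g_map_add) (auto simp: L_tilde_def)
    moreover have "b \<notin> F" using insert.hyps by blast
    ultimately show ?thesis
      using map_add_in_L_tilde[OF c s(1)] s(3,4) insert.hyps(1)
      by (intro bexI[of _ "?c ++ s"]) (auto simp: g_var_def)
  qed
qed simp

text \<open>By injectivity \<open>g_inv\<close> returns \<open>s\<close> itself, so any positive
  position of \<open>s\<close> bounds the depth.\<close>

lemma R1_depth_g_le:
  assumes "s \<in> L_tilde" "t \<in> dom_pos s"
  shows "R1_depth (g s) \<le> t"
proof -
  have "finite (dom_pos s)" using assms(1) by (simp add: L_tilde_def dom_pos_def)
  then have "Min (dom_pos s) \<le> t" using assms(2) by simp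
  then show ?thesis
    unfolding R1_depth_def g_inv_def inv_into_f_f[OF inj_on_g assms(1)] by simp
qed

theorem theorem3p1:
  fixes X :: "'a set" and d :: "'a \<Rightarrow> 'a \<Rightarrow> real"
    and x :: "rat \<Rightarrow> 'a" and w :: "nat \<Rightarrow> word"
  assumes "Metric_space X d"
    and "compact_space (Metric_space.mtopology X d)"
    and "\<And>q. q \<noteq> 0 \<Longrightarrow> x q \<in> X"
    and "w \<in> Q_inf"
  shows "\<exists>u x0. is_extraction u w \<and> x0 \<in> X \<and>
    R1_lim_uniformly (Metric_space.mtopology X d) x
      {FS (\<lambda>n. g_var (u n) (i n) (j n)) | i j. admissible i j} x0 \<and>
    (\<forall>V. openin (Metric_space.mtopology X d) V \<and> x0 \<in> V \<longrightarrow>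
      (\<forall>\<^sub>F n in sequentially. \<forall>i j. admissible i j \<longrightarrow> x (g_var (u n) (i n) (j n)) \<in> V))"
proof -
  interpret Metric_space X d by fact
  obtain x0 where x0: "x0 \<in> X"
    and hom: "\<And>V. (\<And>n::nat. openin mtopology (V n) \<and> x0 \<in> V n) \<Longrightarrow> \<exists>u A.
      (\<forall>n. u n \<in> span_words w True 1) \<and> (\<forall>n. less_R1 (u n) (u (Suc n))) \<and>
      homogeneous u A \<and> (\<forall>n s. A n s \<longrightarrow> x (g s) \<in> V n)"
    using homogeneous_extraction_exists[OF assms(4,2), of "\<lambda>s. x (g s)"] assms(3) g_nonzero
    by (metis (no_types, lifting) topspace_mtopology)
  define ball where "ball n = mball x0 (inverse (real (Suc n)))" for n
  have "openin mtopology (ball n) \<and> x0 \<in> ball n" for n using x0 by (simp add: ball_def)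
  from hom[of ball, OF this] obtain u A where
    u: "\<And>n. u n \<in> span_words w True 1" "\<And>n. less_R1 (u n) (u (Suc n))"
    and hom_u: "homogeneous u A" and ball: "\<And>n s. A n s \<Longrightarrow> x (g s) \<in> ball n"
    by blast
  have ext: "is_extraction u w" using is_extraction_span[of w u, OF assms(4) u] .
  then have uQ: "u \<in> Q_inf" by (simp add: is_extraction_def)
  have sums: "\<exists>s\<in>L_tilde. x (g s) \<in> ball (Min F) \<and> dom s = (\<Union>n\<in>F. dom (u n)) \<and>
      g s = (\<Sum>n\<in>F. g_var (u n) (i n) (j n))"
    if "admissible i j" "finite F" "F \<noteq> {}" "F \<subseteq> {1..}" for i j F
    using finite_sum_word[OF uQ that(1) hom_u that(2-4)] ball by blast
  have small: "\<exists>k. \<forall>n\<ge>k. ball n \<subseteq> V" if V: "openin mtopology V" "x0 \<in> V" for V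
  proof -
    obtain r where r: "r > 0" "mball x0 r \<subseteq> V" using V by (auto simp: openin_mtopology)
    obtain k where k: "inverse (real (Suc k)) < r" using reals_Archimedean r(1) by blast
    have "ball n \<subseteq> V" if "k \<le> n" for n
    proof -
      have "inverse (real (Suc n)) \<le> inverse (real (Suc k))"
        using that by (intro le_imp_inverse_le) auto
      with k have "inverse (real (Suc n)) \<le> r" by linarith
      then have "ball n \<subseteq> mball x0 r" unfolding ball_def by (rule mball_subset_concentric)
      with r(2) show ?thesis by blast
    qed
    then show ?thesis by blast
  qed
  have "\<exists>n0::nat. n0 \<ge> 1 \<and> (\<forall>D\<in>{FS (\<lambda>n. g_var (u n) (i n) (j n)) | i j. admissible i j}.
      \<forall>q\<in>D. int n0 \<le> R1_depth q \<longrightarrow> x q \<in> V)"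
    if V: "openin mtopology V" "x0 \<in> V" for V
  proof -
    obtain k where k: "\<And>n. n \<ge> k \<Longrightarrow> ball n \<subseteq> V" using small[OF V] by blast
    have "\<exists>t. t \<in> dom_pos (u n)" if "n \<ge> 1" for n
      using uQ that by (auto simp: Q_inf_def L0_var_def)
    then obtain t where t: "\<And>n. n \<ge> 1 \<Longrightarrow> t n \<in> dom_pos (u n)" by metis
    \<comment> \<open>\<open>n0\<close> exceeds a positive position of each \<open>u n\<close> with
      \<open>1 \<le> n < k\<close>. It does not involve \<open>i\<close> and \<open>j\<close>, which
      gives uniformity.\<close>
    define n0 where "n0 = Suc (\<Sum>n<k. nat (t n))"
    have "x q \<in> V"
      if ij: "admissible i j" and q: "q \<in> FS (\<lambda>n. g_var (u n) (i n) (j n))" and depth: "int n0 \<le> R1_depth q"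
      for i j q
    proof -
      obtain F where F: "finite F" "F \<noteq> {}" "F \<subseteq> {1..}" "q = (\<Sum>n\<in>F. g_var (u n) (i n) (j n))"
        using q by (auto simp: FS_def)
      obtain s where s: "s \<in> L_tilde" "x (g s) \<in> ball (Min F)" "dom s = (\<Union>n\<in>F. dom (u n))" "g s = q"
        using sums[OF ij F(1-3)] F(4) by auto
      have Min: "Min F \<in> F" using F by simp
      \<comment> \<open>A smaller least index would put the position \<open>t (Min F)\<close>, which
        is below \<open>n0\<close>, into \<open>dom s\<close>, contradicting the depth.\<close>
      have "k \<le> Min F"
      proof (rule ccontr)
        assume "\<not> k \<le> Min F"
        then have "nat (t (Min F)) < n0"
          unfolding n0_def by (intro le_imp_less_Suc member_le_sum) auto
        moreover have "t (Min F) \<in> dom_pos (u (Min F))" using Min F(3) by (intro t) auto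
        then have "t (Min F) \<in> dom_pos s" unfolding dom_pos_def s(3) using Min by blast
        then have "R1_depth q \<le> t (Min F)" using R1_depth_g_le[OF s(1)] s(4) by simp
        ultimately show False using depth by linarith
      qed
      then show ?thesis using k s(2,4) by blast
    qed
    then show ?thesis by (intro exI[of _ n0]) (auto simp: n0_def)
  qed
  then have lim: "R1_lim_uniformly mtopology x
      {FS (\<lambda>n. g_var (u n) (i n) (j n)) | i j. admissible i j} x0"
    using x0 by (simp add: R1_lim_uniformly_def)
  have "\<forall>\<^sub>F n in sequentially. \<forall>i j. admissible i j \<longrightarrow> x (g_var (u n) (i n) (j n)) \<in> V"
    if V: "openin mtopology V" "x0 \<in> V" for V
  proof -
    obtain k where k: "\<And>n. n \<ge> k \<Longrightarrow> ball n \<subseteq> V" using small[OF V] by blast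
    \<comment> \<open>The single terms are the sums over singletons, with least index
      \<open>n\<close>.\<close>
    have "x (g_var (u n) (i n) (j n)) \<in> V" if "n \<ge> max 1 k" "admissible i j" for n i j
      using sums[OF that(2), of "{n}"] that(1) k[of n] by auto
    then show ?thesis unfolding eventually_sequentially by blast
  qed
  with ext x0 lim show ?thesis by blast
qed

end
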